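(* Let $L$ be a $\sigma$-frame, let $\mu$ be a measure on $\mathsf{S}(L)$, and let $g\in\mathsf{SM}(\mathcal{C}(L))$ be a nonnegative simple function. Then the indefinite integral of $g$, i.e. the map $\eta\colon\mathsf{S}(L)\to[0,\infty]$, $\eta(S)=\int_S g\,d\mu$, is a measure on $\mathsf{S}(L)$.
   Context: A $\sigma$-frame is a bounded lattice with all countable joins in which $(\bigvee_{a\in A}a)\wedge b=\bigvee_{a\in A}(a\wedge b)$ for every countable $A$ and every $b$. A $\sigma$-frame homomorphism preserves finite meets (including the top) and countable joins (including the bottom). A congruence on a $\sigma$-frame $L$ is an equivalence relation on $L$ closed under binary meets and countable joins. $\mathcal{C}(L)$, the set of all congruences ordered by inclusion, is a frame. $\mathsf{S}(L)$ is the dual lattice $\mathcal{C}(L)^{op}$ (a coframe); its elements are the $\sigma$-sublocales of $L$. The congruence corresponding to $S\in\mathsf{S}(L)$ is $\theta_S$, so $S\le T$ iff $\theta_T\subseteq\theta_S$, and $\theta_{S\wedge T}=\theta_S\vee\theta_T$, $\theta_{S\vee T}=\theta_S\wedge\theta_T$. The bottom $0_{\mathsf{S}(L)}$ corresponds to $L\times L$ and the top $1_{\mathsf{S}(L)}$ to equality. Complements are denoted $(\cdot)^c$. A measure on a lattice $K$ with bottom and countable joins is a map $\mu\colon K\to[0,\infty]$ with: (M1) $\mu(0)=0$; (M2) $x\le y\Rightarrow\mu(x)\le\mu(y)$; (M3) $\mu(x)+\mu(y)=\mu(x\vee y)+\mu(x\wedge y)$; (M4) $\mu(\bigvee_i x_i)=\sup_i\mu(x_i)$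 for every increasing sequence $(x_i)_{i\in\mathbb{N}}$. $\mathfrak{L}(\mathbb{R})$ is the frame, equivalently $\sigma$-frame, generated by symbols $(p,\text{---})$, $(\text{---},q)$ ($p,q\in\mathbb{Q}$) subject to: $(p,\text{---})\wedge(\text{---},q)=0$ if $p\ge q$; $(p,\text{---})\vee(\text{---},q)=1$ if $p<q$; $(p,\text{---})=\bigvee_{r>p}(r,\text{---})$; $(\text{---},q)=\bigvee_{s<q}(\text{---},s)$; $\bigvee_p(p,\text{---})=1=\bigvee_q(\text{---},q)$. For a $\sigma$-frame $N$, $\mathsf{M}(N)$ is the set of $\sigma$-frame homomorphisms $\mathfrak{L}(\mathbb{R})\to N$, ordered by $f\le g$ iff $f(p,\text{---})\le g(p,\text{---})$ for all $p$. Operations on $\mathsf{M}(N)$: $(\lambda\cdot f)(p,\text{---})=f(p/\lambda,\text{---})$, $(\lambda\cdot f)(\text{---},q)=f(\text{---},q/\lambda)$ for rational $\lambda>0$; $(-f)(p,\text{---})=f(\text{---},-p)$, $(-f)(\text{---},q)=f(-q,\text{---})$; $0\cdot f=\mathbf{0}$ and $\lambda\cdot f=-((-\lambda)\cdot f)$ for $\lambda<0$; $(f+g)(p,\text{---})=\bigvee_{t\in\mathbb{Q}}(f(t,\text{---})\wedge g(p-t,\text{---}))$, $(f+g)(\text{---},q)=\bigvee_{t\in\mathbb{Q}}(f(\text{---},t)\wedge g(\text{---},q-t))$. Here $\mathbf{0}(p,\text{---})=1$ if $p<0$, else $0$; $\mathbf{0}(\text{---},q)=1$ if $q>0$, else $0$.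 $f$ is nonnegative if $f\ge\mathbf{0}$. For complemented $a\in N$, $\chi_a(p,\text{---})=1$ if $p<0$, $a$ if $0\le p<1$, $0$ if $p\ge1$; $\chi_a(\text{---},q)=0$ if $q\le0$, $a^c$ if $0<q\le1$, $1$ if $q>1$. $\mathsf{SM}(N)$ is the set of simple functions: those $f\in\mathsf{M}(N)$ of the form $\sum_{i=1}^n r_i\cdot\chi_{a_i}$ with $r_i\in\mathbb{Q}$ and $a_i\in N$ complemented. Every simple function has a unique canonical form $\sum_{i=1}^n r_i\cdot\chi_{a_i}$ with $r_1<\cdots<r_n$ and the $a_i$ nonzero, complemented, pairwise disjoint, with $\bigvee_i a_i=1$ ($n=0$, the empty sum $\mathbf{0}$, is allowed and occurs only when $N$ is trivial). Integral: if $g\in\mathsf{SM}(\mathcal{C}(L))$ is nonnegative with canonical form $\sum_{i=1}^n r_i\cdot\chi_{\theta_{S_i}^c}$, then for $S\in\mathsf{S}(L)$, $\int_S g\,d\mu=\sum_{i=1}^n r_i\,\mu(S_i\wedge S)\in[0,\infty]$, with $0\cdot\infty=0$. *)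

theory Defs
  imports
    "HOL-Library.Extended_Nonnegative_Real"
    "HOL-Library.Dual_Ordered_Lattice"
begin

section \<open>Lattices with countable joins and sigma-frames\<close>

text \<open>\<open>Sup A\<close> is only specified for countable \<open>A\<close>; its value on uncountable sets is never used.\<close>

class countable_join_lattice = bounded_lattice_bot + Sup +
  assumes countable_Sup_upper: "countable A \<Longrightarrow> x \<in> A \<Longrightarrow> x \<le> Sup A"
    and countable_Sup_least: "countable A \<Longrightarrow> (\<And>x. x \<in> A \<Longrightarrow> x \<le> z) \<Longrightarrow> Sup A \<le> z"

class sigma_frame = countable_join_lattice + bounded_lattice +
  assumes countable_Sup_inf: "countable A \<Longrightarrow> inf (Sup A) b = Sup ((\<lambda>a. inf a b) ` A)"

subclass (in complete_lattice) countable_join_lattice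
  by standard (auto intro: Sup_upper Sup_least)

context countable_join_lattice
begin

lemma countable_Sup_empty: "Sup {} = bot"
  by (rule order.antisym) (auto intro: countable_Sup_least)

lemma countable_Sup_pair: "Sup {a, b} = sup a b"
  by (rule order.antisym) (auto intro: countable_Sup_least countable_Sup_upper)

end

subclass (in sigma_frame) distrib_lattice
proof
  fix x y z :: 'a
  have inf_sup: "inf (sup a b) c = sup (inf a c) (inf b c)" for a b c
    using countable_Sup_inf[of "{a, b}" c] by (simp add: countable_Sup_pair)
  have "inf (sup x y) (sup x z) = sup (inf x (sup x z)) (inf y (sup x z))"
    by (rule inf_sup)
  also have "\<dots> = sup x (inf (sup x z) y)"
    by (simp add: inf_sup_absorb inf_commute)
  also have "\<dots> = sup x (sup (inf x y) (inf z y))"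
    by (simp add: inf_sup)
  also have "\<dots> = sup x (inf y z)"
    by (simp add: sup_assoc[symmetric] sup_inf_absorb inf_commute)
  finally show "sup x (inf y z) = inf (sup x y) (sup x z)" by simp
qed

definition sigma_frame_hom :: "('a::sigma_frame \<Rightarrow> 'b::sigma_frame) \<Rightarrow> bool" where
  "sigma_frame_hom h \<longleftrightarrow>
     h top = top \<and> (\<forall>x y. h (inf x y) = inf (h x) (h y)) \<and>
     (\<forall>A. countable A \<longrightarrow> h (Sup A) = Sup (h ` A))"

definition is_complement :: "'a::bounded_lattice \<Rightarrow> 'a \<Rightarrow> bool" where
  "is_complement a b \<longleftrightarrow> inf a b = bot \<and> sup a b = top"

definition complemented :: "'a::bounded_lattice \<Rightarrow> bool" where
  "complemented a \<longleftrightarrow> (\<exists>b. is_complement a b)"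

definition compl :: "'a::bounded_lattice \<Rightarrow> 'a" where
  "compl a = (THE b. is_complement a b)"


section \<open>Congruences and sigma-sublocales\<close>

text \<open>Closure under countable joins is closure of the relation, as a subset of the product
  \<open>L \<times> L\<close>, under the componentwise joins of its countable subsets.\<close>

definition is_congruence :: "('a::sigma_frame \<times> 'a) set \<Rightarrow> bool" where
  "is_congruence r \<longleftrightarrow> equiv UNIV r \<and>
     (\<forall>a b c d. (a, b) \<in> r \<longrightarrow> (c, d) \<in> r \<longrightarrow> (inf a c, inf b d) \<in> r) \<and>
     (\<forall>A. countable A \<longrightarrow> A \<subseteq> r \<longrightarrow> (Sup (fst ` A), Sup (snd ` A)) \<in> r)"

lemma is_congruenceD:
  assumes "is_congruence r"
  shows "(a, a) \<in> r"
    and "(a, b) \<in> r \<Longrightarrow> (b, a) \<in> r"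
    and "(a, b) \<in> r \<Longrightarrow> (b, c) \<in> r \<Longrightarrow> (a, c) \<in> r"
    and "(a, b) \<in> r \<Longrightarrow> (c, d) \<in> r \<Longrightarrow> (inf a c, inf b d) \<in> r"
    and "countable A \<Longrightarrow> A \<subseteq> r \<Longrightarrow> (Sup (fst ` A), Sup (snd ` A)) \<in> r"
proof -
  have r: "refl r" "sym r" "trans r"
    using assms by (auto simp: is_congruence_def equiv_def)
  show "(a, a) \<in> r" using r(1) by (simp add: refl_on_def)
  show "(a, b) \<in> r \<Longrightarrow> (b, a) \<in> r" using r(2) by (rule symD)
  show "(a, b) \<in> r \<Longrightarrow> (b, c) \<in> r \<Longrightarrow> (a, c) \<in> r" using r(3) by (rule transD)
  show "(a, b) \<in> r \<Longrightarrow> (c, d) \<in> r \<Longrightarrow> (inf a c, inf b d) \<in> r"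
    using assms by (simp add: is_congruence_def)
  show "countable A \<Longrightarrow> A \<subseteq> r \<Longrightarrow> (Sup (fst ` A), Sup (snd ` A)) \<in> r"
    using assms by (simp add: is_congruence_def)
qed

lemma is_congruenceI:
  assumes "\<And>a. (a, a) \<in> r"
    and "\<And>a b. (a, b) \<in> r \<Longrightarrow> (b, a) \<in> r"
    and "\<And>a b c. (a, b) \<in> r \<Longrightarrow> (b, c) \<in> r \<Longrightarrow> (a, c) \<in> r"
    and "\<And>a b c d. (a, b) \<in> r \<Longrightarrow> (c, d) \<in> r \<Longrightarrow> (inf a c, inf b d) \<in> r"
    and "\<And>A. countable A \<Longrightarrow> A \<subseteq> r \<Longrightarrow> (Sup (fst ` A), Sup (snd ` A)) \<in> r"
  shows "is_congruence r"
proof -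
  have "refl r" by (rule refl_onI) (rule assms(1))
  moreover have "sym r" by (rule symI) (rule assms(2))
  moreover have "trans r" by (rule transI) (rule assms(3))
  ultimately have "equiv UNIV r" by (simp add: equiv_def)
  then show ?thesis using assms(4,5) by (simp add: is_congruence_def)
qed

lemma is_congruence_Inter:
  assumes R: "\<And>r. r \<in> R \<Longrightarrow> is_congruence r"
  shows "is_congruence (\<Inter>R)"
proof (rule is_congruenceI; rule InterI)
  fix r assume r: "r \<in> R"
  note rD = is_congruenceD[OF R[OF r]]
  have mem: "x \<in> \<Inter>R \<Longrightarrow> x \<in> r" for x using r by simp
  show "(a, a) \<in> r" for a by (rule rD(1))
  show "(b, a) \<in> r" if "(a, b) \<in> \<Inter>R" for a b
    by (rule rD(2)[OF mem[OF that]])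
  show "(a, c) \<in> r" if "(a, b) \<in> \<Inter>R" "(b, c) \<in> \<Inter>R" for a b c
    by (rule rD(3)[OF mem[OF that(1)] mem[OF that(2)]])
  show "(inf a c, inf b d) \<in> r" if "(a, b) \<in> \<Inter>R" "(c, d) \<in> \<Inter>R" for a b c d
    by (rule rD(4)[OF mem[OF that(1)] mem[OF that(2)]])
  show "(Sup (fst ` A), Sup (snd ` A)) \<in> r" if "countable A" "A \<subseteq> \<Inter>R" for A
    by (rule rD(5)[OF that(1)]) (use that(2) mem in auto)
qed

lemma is_congruence_sup:
  assumes r: "is_congruence r" and "(a, b) \<in> r" "(c, d) \<in> r"
  shows "(sup a c, sup b d) \<in> r"
  using is_congruenceD(5)[OF r, of "{(a, b), (c, d)}"] assms(2,3)
  by (simp add: countable_Sup_pair)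

lemma is_congruence_Id: "is_congruence Id"
proof (rule is_congruenceI)
  fix A :: "('a \<times> 'a) set"
  assume "A \<subseteq> Id"
  then have "fst ` A = snd ` A" by (force simp: image_iff)
  then show "(Sup (fst ` A), Sup (snd ` A)) \<in> Id" by simp
qed auto

typedef (overloaded) 'a congruence = "{r :: ('a::sigma_frame \<times> 'a) set. is_congruence r}"
  morphisms rel Congruence
  using is_congruence_Id by auto

setup_lifting type_definition_congruence

lemma is_congruence_rel: "is_congruence (rel \<theta>)"
  using rel by auto

instantiation congruence :: (sigma_frame) complete_lattice
begin

lift_definition less_eq_congruence :: "'a congruence \<Rightarrow> 'a congruence \<Rightarrow> bool" is "(\<subseteq>)" .

definition less_congruence :: "'a congruence \<Rightarrow> 'a congruence \<Rightarrow> bool" where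
  "less_congruence \<theta> \<phi> \<longleftrightarrow> \<theta> \<le> \<phi> \<and> \<not> \<phi> \<le> \<theta>"

lift_definition Inf_congruence :: "'a congruence set \<Rightarrow> 'a congruence" is "\<lambda>R. \<Inter>R"
  by (rule is_congruence_Inter) auto

definition Sup_congruence :: "'a congruence set \<Rightarrow> 'a congruence" where
  "Sup_congruence A = Inf {\<phi>. \<forall>\<theta>\<in>A. \<theta> \<le> \<phi>}"

definition inf_congruence :: "'a congruence \<Rightarrow> 'a congruence \<Rightarrow> 'a congruence" where
  "inf_congruence \<theta> \<phi> = Inf {\<theta>, \<phi>}"

definition sup_congruence :: "'a congruence \<Rightarrow> 'a congruence \<Rightarrow> 'a congruence" where
  "sup_congruence \<theta> \<phi> = Sup {\<theta>, \<phi>}"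

definition bot_congruence :: "'a congruence" where "bot_congruence = Sup {}"

definition top_congruence :: "'a congruence" where "top_congruence = Inf {}"

instance
proof
  have lower: "\<theta> \<in> A \<Longrightarrow> Inf A \<le> \<theta>" for \<theta> :: "'a congruence" and A
    by transfer auto
  have greatest: "(\<And>\<theta>. \<theta> \<in> A \<Longrightarrow> \<phi> \<le> \<theta>) \<Longrightarrow> \<phi> \<le> Inf A" for \<phi> :: "'a congruence" and A
    by transfer auto
  have upper: "\<theta> \<in> A \<Longrightarrow> \<theta> \<le> Sup A" for \<theta> :: "'a congruence" and A
    unfolding Sup_congruence_def by (rule greatest) auto
  have least: "(\<And>\<theta>. \<theta> \<in> A \<Longrightarrow> \<theta> \<le> \<phi>) \<Longrightarrow> Sup A \<le> \<phi>" for \<phi> :: "'a congruence" and A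
    unfolding Sup_congruence_def by (rule lower) auto
  fix x y z :: "'a congruence" and A :: "'a congruence set"
  show "x \<le> x" "x \<le> y \<Longrightarrow> y \<le> z \<Longrightarrow> x \<le> z" "x \<le> y \<Longrightarrow> y \<le> x \<Longrightarrow> x = y"
    by (transfer; auto)+
  show "(x < y) = (x \<le> y \<and> \<not> y \<le> x)" by (rule less_congruence_def)
  show "inf x y \<le> x" "inf x y \<le> y" by (auto simp: inf_congruence_def intro: lower)
  show "x \<le> y \<Longrightarrow> x \<le> z \<Longrightarrow> x \<le> inf y z" by (auto simp: inf_congruence_def intro: greatest)
  show "x \<le> sup x y" "y \<le> sup x y" by (auto simp: sup_congruence_def intro: upper)
  show "y \<le> x \<Longrightarrow> z \<le> x \<Longrightarrow> sup y z \<le> x" by (auto simp: sup_congruence_def intro: least)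
  show "x \<in> A \<Longrightarrow> Inf A \<le> x" by (rule lower)
  show "(\<And>x. x \<in> A \<Longrightarrow> z \<le> x) \<Longrightarrow> z \<le> Inf A" by (rule greatest)
  show "x \<in> A \<Longrightarrow> x \<le> Sup A" by (rule upper)
  show "(\<And>x. x \<in> A \<Longrightarrow> x \<le> z) \<Longrightarrow> Sup A \<le> z" by (rule least)
qed (simp_all add: bot_congruence_def top_congruence_def)

end

lemma rel_inf: "rel (inf \<theta> \<phi>) = rel \<theta> \<inter> rel \<phi>"
  unfolding inf_congruence_def Inf_congruence.rep_eq by simp

lemma rel_top: "rel top = UNIV"
  unfolding top_congruence_def Inf_congruence.rep_eq by simp

lemma rel_bot: "rel (bot :: 'a::sigma_frame congruence) = Id"
proof
  have "bot \<le> Congruence (Id :: ('a \<times> 'a) set)" by simp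
  then show "rel (bot :: 'a congruence) \<subseteq> Id"
    by (simp add: less_eq_congruence.rep_eq Congruence_inverse is_congruence_Id)
  show "Id \<subseteq> rel (bot :: 'a congruence)"
    using is_congruenceD(1)[OF is_congruence_rel] by auto
qed

text \<open>The Heyting implication of the lattice of congruences.\<close>

lift_definition congruence_imp :: "'a::sigma_frame congruence \<Rightarrow> 'a congruence \<Rightarrow> 'a congruence"
  is "\<lambda>\<phi> \<psi>. {(a, b). \<forall>c d. c \<le> d \<longrightarrow> (c, d) \<in> \<phi> \<longrightarrow>
        (inf (sup a c) d, inf (sup b c) d) \<in> \<psi>}"
proof -
  fix \<phi> \<psi> :: "('a \<times> 'a) set"
  assume \<psi>: "is_congruence \<psi>"
  note \<psi>D = is_congruenceD[OF \<psi>]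
  let ?r = "{(a, b). \<forall>c d. c \<le> d \<longrightarrow> (c, d) \<in> \<phi> \<longrightarrow> (inf (sup a c) d, inf (sup b c) d) \<in> \<psi>}"
  show "is_congruence ?r"
  proof (rule is_congruenceI)
    fix a b c' d' assume "(a, b) \<in> ?r" "(c', d') \<in> ?r"
    moreover have "inf (sup (inf x y) c) d = inf (inf (sup x c) d) (inf (sup y c) d)"
      for x y c d :: 'a
      by (simp add: sup_inf_distrib2 inf_left_commute inf_assoc)
    ultimately show "(inf a c', inf b d') \<in> ?r"
      by (auto intro: \<psi>D(4))
  next
    fix A assume A: "countable A" "A \<subseteq> ?r"
    show "(Sup (fst ` A), Sup (snd ` A)) \<in> ?r"
    proof (clarify)
      fix c d assume cd: "c \<le> d" "(c, d) \<in> \<phi>"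
      define B where "B = insert (c, c) ((\<lambda>(a, b). (inf (sup a c) d, inf (sup b c) d)) ` A)"
      have B: "countable B" "B \<subseteq> \<psi>"
        using A cd \<psi>D(1) by (auto simp: B_def)
      have eq: "inf (sup (Sup X) c) d = Sup (insert c ((\<lambda>x. inf (sup x c) d) ` X))"
        if X: "countable X" for X
      proof (rule antisym)
        let ?Y = "insert c ((\<lambda>x. inf (sup x c) d) ` X)"
        have Y: "countable ?Y" using X by auto
        have "inf (sup (Sup X) c) d = sup (inf (Sup X) d) c"
          using cd(1) by (simp add: inf_sup_distrib2 inf_absorb1)
        also have "\<dots> \<le> Sup ?Y"
        proof (rule sup_least)
          show "c \<le> Sup ?Y" using Y by (auto intro: countable_Sup_upper)
          have "Sup ((\<lambda>x. inf x d) ` X) \<le> Sup ?Y"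
          proof (rule countable_Sup_least)
            fix y assume "y \<in> (\<lambda>x. inf x d) ` X"
            then obtain x where x: "x \<in> X" "y = inf x d" by auto
            have "y \<le> inf (sup x c) d" using x by (simp add: le_infI1)
            also have "\<dots> \<le> Sup ?Y" using Y x by (auto intro!: countable_Sup_upper)
            finally show "y \<le> Sup ?Y" .
          qed (use X in auto)
          then show "inf (Sup X) d \<le> Sup ?Y" by (simp add: countable_Sup_inf[OF X])
        qed
        finally show "inf (sup (Sup X) c) d \<le> Sup ?Y" .
        show "Sup ?Y \<le> inf (sup (Sup X) c) d"
        proof (rule countable_Sup_least[OF Y])
          fix y assume "y \<in> ?Y"
          then consider "y = c" | x where "x \<in> X" "y = inf (sup x c) d" by auto
          then show "y \<le> inf (sup (Sup X) c) d"
          proof cases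
            case 1
            then show ?thesis using cd(1) by simp
          next
            case 2
            then show ?thesis
              using countable_Sup_upper[OF X 2(1)] by (simp only: inf_mono sup_mono order_refl)
          qed
        qed
      qed
      have "fst ` B = insert c ((\<lambda>x. inf (sup x c) d) ` (fst ` A))"
        "snd ` B = insert c ((\<lambda>x. inf (sup x c) d) ` (snd ` A))"
        by (auto simp: B_def image_image case_prod_unfold)
      then show "(inf (sup (Sup (fst ` A)) c) d, inf (sup (Sup (snd ` A)) c) d) \<in> \<psi>"
        using \<psi>D(5)[OF B] A(1) by (simp add: eq)
    qed
  next
    show "(a, a) \<in> ?r" for a using \<psi>D(1) by simp
    show "(b, a) \<in> ?r" if "(a, b) \<in> ?r" for a b using that \<psi>D(2) by simp
    show "(a, c) \<in> ?r" if "(a, b) \<in> ?r" "(b, c) \<in> ?r" for a b c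
      using that \<psi>D(3) by blast
  qed
qed

lemma congruence_imp_adjoint:
  fixes \<chi> \<phi> \<psi> :: "'a::sigma_frame congruence"
  shows "inf \<chi> \<phi> \<le> \<psi> \<longleftrightarrow> \<chi> \<le> congruence_imp \<phi> \<psi>"
proof
  note \<chi>D = is_congruenceD[OF is_congruence_rel[of \<chi>]]
  note \<phi>D = is_congruenceD[OF is_congruence_rel[of \<phi>]]
  note \<psi>D = is_congruenceD[OF is_congruence_rel[of \<psi>]]
  {
    assume le: "inf \<chi> \<phi> \<le> \<psi>"
    have "(inf (sup a c) d, inf (sup b c) d) \<in> rel \<psi>"
      if ab: "(a, b) \<in> rel \<chi>" and cd: "c \<le> d" "(c, d) \<in> rel \<phi>" for a b c d
    proof -
      let ?t = "\<lambda>x. inf (sup x c) d"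
      have "(?t a, ?t b) \<in> rel \<chi>"
        by (intro \<chi>D(4) \<chi>D(1) is_congruence_sup[OF is_congruence_rel] ab)
      moreover have "(?t x, c) \<in> rel \<phi>" for x
      proof -
        have "(inf (sup x c) c, ?t x) \<in> rel \<phi>" by (intro \<phi>D(4) \<phi>D(1) cd(2))
        then show ?thesis by (simp add: inf_absorb2 \<phi>D(2))
      qed
      then have "(?t a, ?t b) \<in> rel \<phi>" using \<phi>D(2,3) by blast
      ultimately show ?thesis using le by (auto simp: less_eq_congruence.rep_eq rel_inf)
    qed
    then show "\<chi> \<le> congruence_imp \<phi> \<psi>"
      by (auto simp: less_eq_congruence.rep_eq congruence_imp.rep_eq)
  }
  {
    assume le: "\<chi> \<le> congruence_imp \<phi> \<psi>"
    have "(a, b) \<in> rel \<psi>" if ab: "(a, b) \<in> rel \<chi>" "(a, b) \<in> rel \<phi>" for a b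
    proof -
      let ?c = "inf a b" and ?d = "sup a b"
      have "(inf a a, inf a b) \<in> rel \<phi>" by (rule \<phi>D(4)[OF \<phi>D(1) ab(2)])
      moreover have "(sup a a, sup a b) \<in> rel \<phi>"
        by (rule is_congruence_sup[OF is_congruence_rel \<phi>D(1) ab(2)])
      ultimately have "(?c, ?d) \<in> rel \<phi>" by (metis \<phi>D(2) \<phi>D(3) inf_idem sup_idem)
      moreover have "?c \<le> ?d" by (simp add: le_supI1)
      ultimately have "(inf (sup a ?c) ?d, inf (sup b ?c) ?d) \<in> rel \<psi>"
        using le ab(1) unfolding less_eq_congruence.rep_eq congruence_imp.rep_eq by blast
      then show ?thesis
        by (simp add: sup_absorb1 inf_absorb1)
    qed
    then show "inf \<chi> \<phi> \<le> \<psi>" by (auto simp: less_eq_congruence.rep_eq rel_inf)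
  }
qed

instance congruence :: (sigma_frame) sigma_frame
proof
  fix A :: "'a congruence set" and b :: "'a congruence"
  show "inf (Sup A) b = Sup ((\<lambda>a. inf a b) ` A)"
  proof (rule antisym)
    have "a \<le> congruence_imp b (Sup ((\<lambda>a. inf a b) ` A))" if "a \<in> A" for a
      unfolding congruence_imp_adjoint[symmetric] using that by (auto intro: Sup_upper)
    then have "Sup A \<le> congruence_imp b (Sup ((\<lambda>a. inf a b) ` A))" by (rule Sup_least)
    then show "inf (Sup A) b \<le> Sup ((\<lambda>a. inf a b) ` A)"
      unfolding congruence_imp_adjoint .
    show "Sup ((\<lambda>a. inf a b) ` A) \<le> inf (Sup A) b"
      by (auto intro!: Sup_least intro: le_infI1 Sup_upper)
  qed
qed

text \<open>\<open>S(L)\<close> is the order dual of \<open>C(L)\<close>: the congruence \<open>\<theta>\<^sub>S\<close> is \<open>undual S\<close>.\<close>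

type_synonym 'a sigma_sublocale = "'a congruence dual"


section \<open>Measures\<close>

definition lattice_measure :: "('k::countable_join_lattice \<Rightarrow> ennreal) \<Rightarrow> bool" where
  "lattice_measure \<mu> \<longleftrightarrow>
     \<mu> bot = 0 \<and>
     (\<forall>x y. x \<le> y \<longrightarrow> \<mu> x \<le> \<mu> y) \<and>
     (\<forall>x y. \<mu> x + \<mu> y = \<mu> (sup x y) + \<mu> (inf x y)) \<and>
     (\<forall>x :: nat \<Rightarrow> 'k. incseq x \<longrightarrow> \<mu> (SUP i. x i) = (SUP i. \<mu> (x i)))"


section \<open>The frame of reals\<close>

text \<open>The sigma-frame presented by the generators \<open>(p,\<emdash>)\<close> and \<open>(\<emdash>,q)\<close> is the
  quotient of the algebra of formal terms by the least preorder that makes the formal operations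
  lattice operations with distributive countable joins and that satisfies the defining relations.
  A relation that equates an element with a join is expressed by the two rules saying that
  the element is a least upper bound of the joinands.\<close>

datatype real_term =
    Above rat
  | Below rat
  | Top
  | Bot
  | Meet real_term real_term
  | Join "nat \<Rightarrow> real_term"

inductive term_le :: "real_term \<Rightarrow> real_term \<Rightarrow> bool" where
  term_refl: "term_le x x"
| term_trans: "term_le x y \<Longrightarrow> term_le y z \<Longrightarrow> term_le x z"
| term_Top: "term_le x Top"
| term_Bot: "term_le Bot x"
| term_Meet1: "term_le (Meet x y) x"
| term_Meet2: "term_le (Meet x y) y"
| term_Meet: "term_le z x \<Longrightarrow> term_le z y \<Longrightarrow> term_le z (Meet x y)"
| term_Join_upper: "term_le (f n) (Join f)"
| term_Join_least: "(\<And>n. term_le (f n) x) \<Longrightarrow> term_le (Join f) x"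
| term_distrib: "term_le (Meet (Join f) y) (Join (\<lambda>n. Meet (f n) y))"
| disjoint: "p \<ge> q \<Longrightarrow> term_le (Meet (Above p) (Below q)) Bot"
| cover: "p < q \<Longrightarrow> term_le (Above p) x \<Longrightarrow> term_le (Below q) x \<Longrightarrow> term_le Top x"
| Above_upper: "r > p \<Longrightarrow> term_le (Above r) (Above p)"
| Above_least: "(\<And>r. r > p \<Longrightarrow> term_le (Above r) x) \<Longrightarrow> term_le (Above p) x"
| Below_upper: "s < q \<Longrightarrow> term_le (Below s) (Below q)"
| Below_least: "(\<And>s. s < q \<Longrightarrow> term_le (Below s) x) \<Longrightarrow> term_le (Below q) x"
| Above_all: "(\<And>p. term_le (Above p) x) \<Longrightarrow> term_le Top x"
| Below_all: "(\<And>q. term_le (Below q) x) \<Longrightarrow> term_le Top x"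

definition term_eq :: "real_term \<Rightarrow> real_term \<Rightarrow> bool" where
  "term_eq x y \<longleftrightarrow> term_le x y \<and> term_le y x"

quotient_type real_frame = real_term / term_eq
  by (rule equivpI)
    (auto simp: term_eq_def reflp_def symp_def transp_def intro: term_refl term_trans)

lift_definition ray_above :: "rat \<Rightarrow> real_frame" is Above .

lift_definition ray_below :: "rat \<Rightarrow> real_frame" is Below .

instantiation real_frame :: sigma_frame
begin

lift_definition less_eq_real_frame :: "real_frame \<Rightarrow> real_frame \<Rightarrow> bool" is term_le
  unfolding term_eq_def by (blast intro: term_trans)

definition less_real_frame :: "real_frame \<Rightarrow> real_frame \<Rightarrow> bool" where
  "less_real_frame x y \<longleftrightarrow> x \<le> y \<and> \<not> y \<le> x"

lift_definition top_real_frame :: real_frame is Top .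

lift_definition bot_real_frame :: real_frame is Bot .

lift_definition inf_real_frame :: "real_frame \<Rightarrow> real_frame \<Rightarrow> real_frame" is Meet
  unfolding term_eq_def by (blast intro: term_trans term_Meet1 term_Meet2 term_Meet)

lift_definition sup_real_frame :: "real_frame \<Rightarrow> real_frame \<Rightarrow> real_frame"
  is "\<lambda>x y. Join (\<lambda>n. if n = 0 then x else y)"
  unfolding term_eq_def
  by (intro conjI term_Join_least; rule term_trans[OF _ term_Join_upper]; auto)

definition Sup_real_frame :: "real_frame set \<Rightarrow> real_frame" where
  "Sup_real_frame A =
     (if A = {} then bot else abs_real_frame (Join (\<lambda>n. rep_real_frame (from_nat_into A n))))"

instance
proof
  have abs_rep: "abs_real_frame (rep_real_frame x) = x" for x
    by (rule Quotient3_abs_rep[OF Quotient3_real_frame])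
  have upper: "x \<le> Sup A" if A: "countable A" "x \<in> A" for x :: real_frame and A
  proof -
    obtain n where "x = from_nat_into A n" using from_nat_into_surj[OF A] by auto
    then have "term_le (rep_real_frame x) (Join (\<lambda>n. rep_real_frame (from_nat_into A n)))"
      using term_Join_upper[of "\<lambda>n. rep_real_frame (from_nat_into A n)" n] by simp
    then have "abs_real_frame (rep_real_frame x) \<le> Sup A"
      using A(2) by (auto simp: Sup_real_frame_def less_eq_real_frame.abs_eq)
    then show ?thesis by (simp add: abs_rep)
  qed
  have least: "Sup A \<le> z" if A: "countable A" "\<And>x. x \<in> A \<Longrightarrow> x \<le> z"
    for z :: real_frame and A
  proof (cases "A = {}")
    case True
    have "bot \<le> z" by transfer (rule term_Bot)
    with True show ?thesis by (simp add: Sup_real_frame_def)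
  next
    case False
    have "term_le (rep_real_frame (from_nat_into A n)) (rep_real_frame z)" for n
      using A(2)[OF from_nat_into[OF False]] by (simp add: less_eq_real_frame.rep_eq)
    then have "term_le (Join (\<lambda>n. rep_real_frame (from_nat_into A n))) (rep_real_frame z)"
      by (rule term_Join_least)
    then have "Sup A \<le> abs_real_frame (rep_real_frame z)"
      using False by (auto simp: Sup_real_frame_def less_eq_real_frame.abs_eq)
    then show ?thesis by (simp add: abs_rep)
  qed
  fix x y z :: real_frame and A :: "real_frame set"
  show "(x < y) = (x \<le> y \<and> \<not> y \<le> x)" by (rule less_real_frame_def)
  show "x \<le> x" by transfer (rule term_refl)
  show "x \<le> y \<Longrightarrow> y \<le> z \<Longrightarrow> x \<le> z" by transfer (rule term_trans)
  show "x \<le> y \<Longrightarrow> y \<le> x \<Longrightarrow> x = y" by transfer (simp add: term_eq_def)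
  show inf1: "inf x y \<le> x" and "inf x y \<le> y" by (transfer, rule term_Meet1 term_Meet2)+
  show "x \<le> y \<Longrightarrow> x \<le> z \<Longrightarrow> x \<le> inf y z" by transfer (rule term_Meet)
  show "x \<le> sup x y"
  proof transfer
    fix x y show "term_le x (Join (\<lambda>n. if n = 0 then x else y))"
      using term_Join_upper[of "\<lambda>n. if n = 0 then x else y" 0] by simp
  qed
  show "y \<le> sup x y"
  proof transfer
    fix x y show "term_le y (Join (\<lambda>n. if n = 0 then x else y))"
      using term_Join_upper[of "\<lambda>n. if n = 0 then x else y" 1] by simp
  qed
  show "y \<le> x \<Longrightarrow> z \<le> x \<Longrightarrow> sup y z \<le> x"
    by transfer (auto intro: term_Join_least)
  show bot: "bot \<le> x" by transfer (rule term_Bot)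
  show "x \<le> top" by transfer (rule term_Top)
  show "countable A \<Longrightarrow> x \<in> A \<Longrightarrow> x \<le> Sup A" by (rule upper)
  show "countable A \<Longrightarrow> (\<And>x. x \<in> A \<Longrightarrow> x \<le> z) \<Longrightarrow> Sup A \<le> z" by (rule least)
  have refl: "a \<le> a" for a :: real_frame by transfer (rule term_refl)
  have trans: "a \<le> b \<Longrightarrow> b \<le> c \<Longrightarrow> a \<le> c" for a b c :: real_frame
    by transfer (rule term_trans)
  have antisym: "a \<le> b \<Longrightarrow> b \<le> a \<Longrightarrow> a = b" for a b :: real_frame
    by transfer (simp add: term_eq_def)
  have inf_lower: "inf a b \<le> a" "inf a b \<le> b" for a b :: real_frame
    by (transfer, rule term_Meet1 term_Meet2)+
  have inf_greatest: "c \<le> a \<Longrightarrow> c \<le> b \<Longrightarrow> c \<le> inf a b" for a b c :: real_frame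
    by transfer (rule term_Meet)
  have bot_least: "bot \<le> a" for a :: real_frame by transfer (rule term_Bot)
  show "inf (Sup A) y = Sup ((\<lambda>a. inf a y) ` A)" if A: "countable A"
  proof (rule antisym)
    let ?S = "Sup ((\<lambda>a. inf a y) ` A)"
    have cA: "countable ((\<lambda>a. inf a y) ` A)" using A by auto
    show "inf (Sup A) y \<le> ?S"
    proof (cases "A = {}")
      case True
      then have "inf (Sup A) y \<le> bot"
        using inf_lower(1)[of "bot" y] by (simp add: Sup_real_frame_def)
      then show ?thesis by (rule trans[OF _ bot_least])
    next
      case False
      let ?f = "\<lambda>n. rep_real_frame (from_nat_into A n)"
      have "term_le (Meet (?f n) (rep_real_frame y)) (rep_real_frame ?S)" for n
      proof -
        have "inf (from_nat_into A n) y \<le> ?S"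
          using from_nat_into[OF False] by (auto intro!: upper[OF cA])
        then have "inf (abs_real_frame (?f n)) (abs_real_frame (rep_real_frame y))
            \<le> abs_real_frame (rep_real_frame ?S)"
          by (simp only: abs_rep)
        then show ?thesis by (simp add: inf_real_frame.abs_eq less_eq_real_frame.abs_eq)
      qed
      then have "term_le (Meet (Join ?f) (rep_real_frame y)) (rep_real_frame ?S)"
        by (intro term_trans[OF term_distrib] term_Join_least)
      then have "inf (abs_real_frame (Join ?f)) (abs_real_frame (rep_real_frame y))
          \<le> abs_real_frame (rep_real_frame ?S)"
        by (simp add: inf_real_frame.abs_eq less_eq_real_frame.abs_eq)
      then show ?thesis using False by (simp add: abs_rep Sup_real_frame_def[of A])
    qed
    show "?S \<le> inf (Sup A) y"
    proof (rule least[OF cA])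
      fix z assume "z \<in> (\<lambda>a. inf a y) ` A"
      then obtain a where a: "a \<in> A" "z = inf a y" by auto
      show "z \<le> inf (Sup A) y"
        unfolding a(2)
        by (rule inf_greatest[OF trans[OF inf_lower(1) upper[OF A a(1)]] inf_lower(2)])
    qed
  qed
qed

end

text \<open>The defining relations, for a prospective interpretation of the generators in a
  sigma-frame.\<close>

definition real_relations :: "(rat \<Rightarrow> 'n::sigma_frame) \<Rightarrow> (rat \<Rightarrow> 'n) \<Rightarrow> bool" where
  "real_relations u v \<longleftrightarrow>
     (\<forall>p q. p \<ge> q \<longrightarrow> inf (u p) (v q) = bot) \<and>
     (\<forall>p q. p < q \<longrightarrow> sup (u p) (v q) = top) \<and>
     (\<forall>p. u p = Sup (u ` {r. r > p})) \<and>
     (\<forall>q. v q = Sup (v ` {s. s < q})) \<and>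
     Sup (range u) = top \<and> Sup (range v) = top"

lemma real_relations_generators: "real_relations ray_above ray_below"
proof -
  have c: "countable (f ` X)" for f :: "rat \<Rightarrow> real_frame" and X
    by (rule countableI_type[THEN countable_image])
  have 1: "inf (ray_above p) (ray_below q) = bot" if "p \<ge> q" for p q
  proof (rule antisym[OF _ bot_least])
    show "inf (ray_above p) (ray_below q) \<le> bot"
      using that by transfer (rule term_le.disjoint)
  qed
  have 2: "sup (ray_above p) (ray_below q) = top" if "p < q" for p q
  proof (rule antisym[OF top_greatest])
    have *: "ray_above p \<le> x \<Longrightarrow> ray_below q \<le> x \<Longrightarrow> top \<le> x" for x
      using that by transfer (rule term_le.cover)
    show "top \<le> sup (ray_above p) (ray_below q)" by (rule *) (rule sup_ge1 sup_ge2)+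
  qed
  have 3: "ray_above p = Sup (ray_above ` {r. r > p})" for p
  proof (rule antisym)
    have *: "(\<And>r. r > p \<Longrightarrow> ray_above r \<le> x) \<Longrightarrow> ray_above p \<le> x" for x
      by transfer (rule Above_least)
    show "ray_above p \<le> Sup (ray_above ` {r. r > p})"
      by (rule *) (rule countable_Sup_upper[OF c], blast)
    have "ray_above r \<le> ray_above p" if "r > p" for r
      using that by transfer (rule Above_upper)
    then show "Sup (ray_above ` {r. r > p}) \<le> ray_above p"
      by (intro countable_Sup_least[OF c]) blast
  qed
  have 4: "ray_below q = Sup (ray_below ` {s. s < q})" for q
  proof (rule antisym)
    have *: "(\<And>s. s < q \<Longrightarrow> ray_below s \<le> x) \<Longrightarrow> ray_below q \<le> x" for x
      by transfer (rule Below_least)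
    show "ray_below q \<le> Sup (ray_below ` {s. s < q})"
      by (rule *) (rule countable_Sup_upper[OF c], blast)
    have "ray_below s \<le> ray_below q" if "s < q" for s
      using that by transfer (rule Below_upper)
    then show "Sup (ray_below ` {s. s < q}) \<le> ray_below q"
      by (intro countable_Sup_least[OF c]) blast
  qed
  have 5: "Sup (range ray_above) = top"
  proof (rule antisym[OF top_greatest])
    have *: "(\<And>p. ray_above p \<le> x) \<Longrightarrow> top \<le> x" for x
      by transfer (rule Above_all)
    show "top \<le> Sup (range ray_above)"
      by (rule *) (rule countable_Sup_upper[OF c], blast)
  qed
  have 6: "Sup (range ray_below) = top"
  proof (rule antisym[OF top_greatest])
    have *: "(\<And>q. ray_below q \<le> x) \<Longrightarrow> top \<le> x" for x
      by transfer (rule Below_all)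
    show "top \<le> Sup (range ray_below)"
      by (rule *) (rule countable_Sup_upper[OF c], blast)
  qed
  show ?thesis
    unfolding real_relations_def
  proof (intro conjI allI impI)
    show "inf (ray_above p) (ray_below q) = bot" if "p \<ge> q" for p q
      using that by (rule 1)
    show "sup (ray_above p) (ray_below q) = top" if "p < q" for p q
      using that by (rule 2)
    show "ray_above p = Sup (ray_above ` {r. r > p})" for p by (rule 3)
    show "ray_below q = Sup (ray_below ` {s. s < q})" for q by (rule 4)
  qed (rule 5 6)+
qed

primrec term_eval :: "(rat \<Rightarrow> 'n::sigma_frame) \<Rightarrow> (rat \<Rightarrow> 'n) \<Rightarrow> real_term \<Rightarrow> 'n" where
  "term_eval u v (Above p) = u p"
| "term_eval u v (Below q) = v q"
| "term_eval u v Top = top"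
| "term_eval u v Bot = bot"
| "term_eval u v (Meet x y) = inf (term_eval u v x) (term_eval u v y)"
| "term_eval u v (Join f) = Sup (range (\<lambda>n. term_eval u v (f n)))"

lemma term_eval_mono:
  assumes uv: "real_relations u v" and "term_le x y"
  shows "term_eval u v x \<le> term_eval u v y"
  using assms(2)
proof induction
  note rels = uv[unfolded real_relations_def]
  have disj: "inf (u p) (v q) = bot" if "p \<ge> q" for p q
    using conjunct1[OF rels] that by blast
  have cov: "sup (u p) (v q) = top" if "p < q" for p q
    using conjunct1[OF conjunct2[OF rels]] that by blast
  have u: "u p = Sup (u ` {r. r > p})" for p
    by (rule spec[OF conjunct1[OF conjunct2[OF conjunct2[OF rels]]]])
  have v: "v q = Sup (v ` {s. s < q})" for q
    by (rule spec[OF conjunct1[OF conjunct2[OF conjunct2[OF conjunct2[OF rels]]]]])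
  have all: "Sup (range u) = top" "Sup (range v) = top"
    by (rule conjunct1 conjunct2, rule conjunct2[OF conjunct2[OF conjunct2[OF conjunct2[OF rels]]]])+
  {
    case (term_trans x y z)
    from term_trans.IH show ?case by (rule order.trans)
  next
    case (term_Join_upper f n)
    show ?case by (auto intro: countable_Sup_upper)
  next
    case (term_Join_least f x)
    then show ?case by (auto intro: countable_Sup_least)
  next
    case (term_distrib f y)
    show ?case by (simp add: countable_Sup_inf image_image)
  next
    case (disjoint q p)
    then show ?case by (simp add: disj)
  next
    case (cover p q x)
    then have "sup (u p) (v q) = top" by (simp add: cov)
    moreover have "sup (u p) (v q) \<le> term_eval u v x" using cover.IH by simp
    ultimately show ?case by simp
  next
    case (Above_upper r p)
    have "u r \<le> Sup (u ` {r. r > p})"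
      by (rule countable_Sup_upper) (use Above_upper in auto)
    then show ?case by (simp add: u[of p, symmetric])
  next
    case (Above_least p x)
    have "Sup (u ` {r. r > p}) \<le> term_eval u v x"
      by (rule countable_Sup_least) (use Above_least.IH in auto)
    then show ?case by (simp add: u[of p, symmetric])
  next
    case (Below_upper s q)
    have "v s \<le> Sup (v ` {s. s < q})"
      by (rule countable_Sup_upper) (use Below_upper in auto)
    then show ?case by (simp add: v[of q, symmetric])
  next
    case (Below_least q x)
    have "Sup (v ` {s. s < q}) \<le> term_eval u v x"
      by (rule countable_Sup_least) (use Below_least.IH in auto)
    then show ?case by (simp add: v[of q, symmetric])
  next
    case (Above_all x)
    have "Sup (range u) \<le> term_eval u v x"
      by (rule countable_Sup_least) (use Above_all.IH in auto)
    then show ?case by (simp add: all top_unique)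
  next
    case (Below_all x)
    have "Sup (range v) \<le> term_eval u v x"
      by (rule countable_Sup_least) (use Below_all.IH in auto)
    then show ?case by (simp add: all top_unique)
  }
qed simp_all

lemma Sup_abs_real_frame: "abs_real_frame (Join f) = Sup (range (\<lambda>n. abs_real_frame (f n)))"
proof (rule antisym)
  let ?S = "Sup (range (\<lambda>n. abs_real_frame (f n)))"
  have abs_rep: "abs_real_frame (rep_real_frame x) = x" for x
    by (rule Quotient3_abs_rep[OF Quotient3_real_frame])
  have "abs_real_frame (f n) \<le> abs_real_frame (rep_real_frame ?S)" for n
    unfolding abs_rep by (auto intro: countable_Sup_upper)
  then have "term_le (Join f) (rep_real_frame ?S)"
    by (auto simp: less_eq_real_frame.abs_eq intro: term_Join_least)
  then have "abs_real_frame (Join f) \<le> abs_real_frame (rep_real_frame ?S)"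
    by (simp add: less_eq_real_frame.abs_eq)
  then show "abs_real_frame (Join f) \<le> ?S" by (simp add: abs_rep)
  show "?S \<le> abs_real_frame (Join f)"
    by (rule countable_Sup_least) (auto simp: less_eq_real_frame.abs_eq intro: term_Join_upper)
qed

lemma real_frame_hom_determined:
  fixes h k :: "real_frame \<Rightarrow> 'n::sigma_frame"
  assumes h: "sigma_frame_hom h" and k: "sigma_frame_hom k"
    and "\<And>p. h (ray_above p) = k (ray_above p)" "\<And>q. h (ray_below q) = k (ray_below q)"
  shows "h = k"
proof
  have eq: "h (abs_real_frame t) = k (abs_real_frame t)" for t
  proof (induction t)
    case (Above p)
    show ?case using assms(3)[of p] by (simp add: ray_above.abs_eq)
  next
    case (Below q)
    show ?case using assms(4)[of q] by (simp add: ray_below.abs_eq)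
  next
    case Top
    show ?case using h k by (simp add: sigma_frame_hom_def top_real_frame_def[symmetric])
  next
    case Bot
    have "h (Sup {}) = Sup (h ` {})" "k (Sup {}) = Sup (k ` {})"
      using h k by (simp_all only: sigma_frame_hom_def countable_empty)
    then show ?case
      by (simp add: countable_Sup_empty bot_real_frame_def[symmetric])
  next
    case (Meet x y)
    then show ?case
      using h k by (simp add: sigma_frame_hom_def inf_real_frame.abs_eq[symmetric])
  next
    case (Join f)
    let ?A = "range (\<lambda>n. abs_real_frame (f n))"
    have "h (Sup ?A) = Sup (h ` ?A)" "k (Sup ?A) = Sup (k ` ?A)"
      using h k by (simp_all add: sigma_frame_hom_def)
    moreover have "h ` ?A = k ` ?A" using Join by (simp add: image_image)
    ultimately show ?case by (simp add: Sup_abs_real_frame)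
  qed
  fix x
  have "abs_real_frame (rep_real_frame x) = x"
    by (rule Quotient3_abs_rep[OF Quotient3_real_frame])
  then show "h x = k x" using eq[of "rep_real_frame x"] by simp
qed

lemma real_frame_universal:
  fixes u v :: "rat \<Rightarrow> 'n::sigma_frame"
  assumes "real_relations u v"
  shows "\<exists>!h. sigma_frame_hom h \<and> (\<forall>p. h (ray_above p) = u p) \<and> (\<forall>q. h (ray_below q) = v q)"
proof (rule ex_ex1I)
  define h where "h = (\<lambda>x. term_eval u v (rep_real_frame x))"
  have abs_rep: "abs_real_frame (rep_real_frame x) = x" for x
    by (rule Quotient3_abs_rep[OF Quotient3_real_frame])
  have h_abs: "h (abs_real_frame t) = term_eval u v t" for t
  proof -
    have "term_eq (rep_real_frame (abs_real_frame t)) t"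
      by (metis abs_rep real_frame.abs_eq_iff)
    then show ?thesis
      unfolding h_def term_eq_def by (auto intro!: antisym term_eval_mono[OF assms])
  qed
  have mono: "h x \<le> h y" if "x \<le> y" for x y
    using that unfolding h_def less_eq_real_frame.rep_eq by (rule term_eval_mono[OF assms])
  have Sup: "h (Sup A) = Sup (h ` A)" if A: "countable A" for A
  proof (cases "A = {}")
    case True
    then show ?thesis by (simp add: countable_Sup_empty bot_real_frame_def h_abs)
  next
    case False
    have "A = range (from_nat_into A)" using A False by (simp add: range_from_nat_into)
    moreover have "h (Sup A) = Sup (range (\<lambda>n. h (from_nat_into A n)))"
      using False by (simp add: Sup_real_frame_def h_abs) (simp add: h_def)
    ultimately show ?thesis by (metis image_image)
  qed
  have "h (inf x y) = inf (h x) (h y)" for x y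
    by (metis abs_rep h_abs inf_real_frame.abs_eq term_eval.simps(5))
  then have "sigma_frame_hom h"
    using Sup by (simp add: sigma_frame_hom_def top_real_frame_def h_abs)
  then show "\<exists>h. sigma_frame_hom h \<and> (\<forall>p. h (ray_above p) = u p) \<and> (\<forall>q. h (ray_below q) = v q)"
    by (intro exI[of _ h]) (simp add: ray_above.abs_eq ray_below.abs_eq h_abs)
qed (auto intro: real_frame_hom_determined)


section \<open>Functions on a sigma-frame\<close>

definition M_homs :: "(real_frame \<Rightarrow> 'n::sigma_frame) set" where
  "M_homs = {f. sigma_frame_hom f}"

definition M_le :: "(real_frame \<Rightarrow> 'n::sigma_frame) \<Rightarrow> (real_frame \<Rightarrow> 'n) \<Rightarrow> bool" where
  "M_le f g \<longleftrightarrow> (\<forall>p. f (ray_above p) \<le> g (ray_above p))"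

text \<open>The element of \<open>M_homs\<close> with prescribed values on the generators. It exists, and is unique,
  when these values satisfy the defining relations (see \<open>real_frame_universal\<close>).\<close>

definition M_of :: "(rat \<Rightarrow> 'n::sigma_frame) \<Rightarrow> (rat \<Rightarrow> 'n) \<Rightarrow> real_frame \<Rightarrow> 'n" where
  "M_of u v = (THE h. h \<in> M_homs \<and> (\<forall>p. h (ray_above p) = u p) \<and> (\<forall>q. h (ray_below q) = v q))"

definition M_zero :: "real_frame \<Rightarrow> 'n::sigma_frame" where
  "M_zero = M_of (\<lambda>p. if p < 0 then top else bot) (\<lambda>q. if q > 0 then top else bot)"

definition M_add :: "(real_frame \<Rightarrow> 'n::sigma_frame) \<Rightarrow> (real_frame \<Rightarrow> 'n) \<Rightarrow> real_frame \<Rightarrow> 'n" where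
  "M_add f g =
     M_of (\<lambda>p. SUP t. inf (f (ray_above t)) (g (ray_above (p - t))))
          (\<lambda>q. SUP t. inf (f (ray_below t)) (g (ray_below (q - t))))"

definition M_uminus :: "(real_frame \<Rightarrow> 'n::sigma_frame) \<Rightarrow> real_frame \<Rightarrow> 'n" where
  "M_uminus f = M_of (\<lambda>p. f (ray_below (- p))) (\<lambda>q. f (ray_above (- q)))"

definition M_scale_pos :: "rat \<Rightarrow> (real_frame \<Rightarrow> 'n::sigma_frame) \<Rightarrow> real_frame \<Rightarrow> 'n" where
  "M_scale_pos l f = M_of (\<lambda>p. f (ray_above (p / l))) (\<lambda>q. f (ray_below (q / l)))"

definition M_scale :: "rat \<Rightarrow> (real_frame \<Rightarrow> 'n::sigma_frame) \<Rightarrow> real_frame \<Rightarrow> 'n" where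
  "M_scale l f =
     (if l > 0 then M_scale_pos l f
      else if l = 0 then M_zero
      else M_uminus (M_scale_pos (- l) f))"

definition M_nonneg :: "(real_frame \<Rightarrow> 'n::sigma_frame) \<Rightarrow> bool" where
  "M_nonneg f \<longleftrightarrow> M_le M_zero f"

definition M_chi :: "'n::sigma_frame \<Rightarrow> real_frame \<Rightarrow> 'n" where
  "M_chi a =
     M_of (\<lambda>p. if p < 0 then top else if p < 1 then a else bot)
          (\<lambda>q. if q \<le> 0 then bot else if q \<le> 1 then compl a else top)"

text \<open>The list \<open>[(r\<^sub>1, a\<^sub>1), \<dots>, (r\<^sub>n, a\<^sub>n)]\<close> stands for the formal sum
  \<open>r\<^sub>1 \<cdot> \<chi>(a\<^sub>1) + \<dots> + r\<^sub>n \<cdot> \<chi>(a\<^sub>n)\<close>.\<close>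

definition M_lincomb :: "(rat \<times> 'n::sigma_frame) list \<Rightarrow> real_frame \<Rightarrow> 'n" where
  "M_lincomb xs = foldr (\<lambda>(r, a) f. M_add (M_scale r (M_chi a)) f) xs M_zero"

definition SM :: "(real_frame \<Rightarrow> 'n::sigma_frame) set" where
  "SM = {f \<in> M_homs. \<exists>xs. (\<forall>(r, a) \<in> set xs. complemented a) \<and> f = M_lincomb xs}"

definition canonical :: "(rat \<times> 'n::sigma_frame) list \<Rightarrow> bool" where
  "canonical xs \<longleftrightarrow>
     sorted_wrt (<) (map fst xs) \<and>
     (\<forall>(r, a) \<in> set xs. a \<noteq> bot \<and> complemented a) \<and>
     sorted_wrt (\<lambda>a b. inf a b = bot) (map snd xs) \<and>
     Sup (set (map snd xs)) = top"

definition canonical_form :: "(real_frame \<Rightarrow> 'n::sigma_frame) \<Rightarrow> (rat \<times> 'n) list" where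
  "canonical_form f = (THE xs. canonical xs \<and> f = M_lincomb xs)"


section \<open>The integral\<close>

text \<open>A canonical coefficient \<open>a = (\<theta>\<^sub>S)\<^sup>c\<close> of \<open>g\<close> determines \<open>S\<close> by \<open>\<theta>\<^sub>S = a\<^sup>c\<close>, that is
  \<open>S = dual (compl a)\<close>. The integral is meaningful only for nonnegative simple \<open>g\<close>, whose
  canonical coefficients satisfy \<open>r \<ge> 0\<close>; \<^const>\<open>ennreal\<close> truncates negative numbers to \<open>0\<close>.\<close>

definition simple_integral ::
  "('a::sigma_frame sigma_sublocale \<Rightarrow> ennreal) \<Rightarrow> (real_frame \<Rightarrow> 'a congruence) \<Rightarrow>
    'a sigma_sublocale \<Rightarrow> ennreal" where
  "simple_integral \<mu> g S =
     (\<Sum>(r, a) \<leftarrow> canonical_form g. ennreal (real_of_rat r) * \<mu> (inf (dual (compl a)) S))"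

end

theory Submission
  imports Defs
begin

text \<open>The integral is a finite sum of multiples of the restrictions \<open>S \<mapsto> \<mu> (T \<sqinter> S)\<close>, where the
  \<open>T\<close> come from the coefficients of the canonical form of \<open>g\<close> and are therefore complemented; meeting
  with a complemented element preserves binary and countable joins, so each restriction is a measure.
  What remains is that the canonical form exists and is unique. For this, call a function constant
  on \<open>a\<close> with value \<open>r\<close> if meeting its values on the generators with \<open>a\<close> gives those of \<open>r\<close>. The
  relations of the frame of reals, and equality of functions, can be checked on the members of a
  cover, so sums and multiples of functions that are constant on the members of a finite cover can
  be computed valuewise on the members of a common refinement.\<close>

section \<open>Operations on lattice measures\<close>

lemma lattice_measureD:
  assumes "lattice_measure \<mu>"
  shows "\<mu> bot = 0"
    and "x \<le> y \<Longrightarrow> \<mu> x \<le> \<mu> y"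
    and "\<mu> x + \<mu> y = \<mu> (sup x y) + \<mu> (inf x y)"
    and "incseq X \<Longrightarrow> \<mu> (SUP i. X i) = (SUP i. \<mu> (X i))"
  using assms unfolding lattice_measure_def by blast+

lemma lattice_measure_0: "lattice_measure (\<lambda>x. 0)"
  by (simp add: lattice_measure_def)

lemma lattice_measure_add:
  assumes \<mu>: "lattice_measure \<mu>" and \<nu>: "lattice_measure \<nu>"
  shows "lattice_measure (\<lambda>x. \<mu> x + \<nu> x)"
proof -
  note \<mu>D = lattice_measureD[OF \<mu>] and \<nu>D = lattice_measureD[OF \<nu>]
  show ?thesis
    unfolding lattice_measure_def
  proof (intro conjI allI impI)
    show "\<mu> bot + \<nu> bot = 0" using \<mu>D(1) \<nu>D(1) by simp
    show "\<mu> x + \<nu> x \<le> \<mu> y + \<nu> y" if "x \<le> y" for x y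
      using that by (intro add_mono \<mu>D(2) \<nu>D(2))
    show "(\<mu> x + \<nu> x) + (\<mu> y + \<nu> y) = (\<mu> (sup x y) + \<nu> (sup x y)) + (\<mu> (inf x y) + \<nu> (inf x y))"
      for x y
      using \<mu>D(3)[of x y] \<nu>D(3)[of x y] by (metis add.assoc add.left_commute)
    show "\<mu> (SUP i. X i) + \<nu> (SUP i. X i) = (SUP i. \<mu> (X i) + \<nu> (X i))"
      if X: "incseq X" for X :: "nat \<Rightarrow> _"
    proof -
      \<comment> \<open>Suprema are exchanged with the sum along increasing sequences, so
        monotonicity is first transferred to the values.\<close>
      have "incseq (\<lambda>i. \<mu> (X i))" "incseq (\<lambda>i. \<nu> (X i))"
        using X by (auto simp: incseq_def intro: \<mu>D(2) \<nu>D(2))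
      then show ?thesis
        by (simp add: \<mu>D(4)[OF X] \<nu>D(4)[OF X] ennreal_SUP_add)
    qed
  qed
qed

lemma lattice_measure_mult:
  assumes \<mu>: "lattice_measure \<mu>"
  shows "lattice_measure (\<lambda>x. c * \<mu> x)"
proof -
  note \<mu>D = lattice_measureD[OF \<mu>]
  show ?thesis
    unfolding lattice_measure_def
  proof (intro conjI allI impI)
    show "c * \<mu> bot = 0" using \<mu>D(1) by simp
    show "c * \<mu> x \<le> c * \<mu> y" if "x \<le> y" for x y
      using that by (intro mult_left_mono \<mu>D(2)) simp_all
    show "c * \<mu> x + c * \<mu> y = c * \<mu> (sup x y) + c * \<mu> (inf x y)" for x y
      using \<mu>D(3)[of x y] by (simp add: distrib_left[symmetric])
    show "c * \<mu> (SUP i. X i) = (SUP i. c * \<mu> (X i))" if X: "incseq X" for X :: "nat \<Rightarrow> _"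
      by (simp add: \<mu>D(4)[OF X] SUP_mult_left_ennreal)
  qed
qed

lemma lattice_measure_sum_list:
  assumes "\<And>i. i \<in> set xs \<Longrightarrow> lattice_measure (\<mu> i)"
  shows "lattice_measure (\<lambda>x. \<Sum>i\<leftarrow>xs. \<mu> i x)"
  using assms by (induction xs) (simp_all add: lattice_measure_0 lattice_measure_add)

text \<open>Meeting with \<open>a\<close> is left adjoint to joining with its complement
  \<open>b\<close>. This yields preservation of joins and, at \<open>z = bot\<close>, uniqueness of
  complements.\<close>

lemma complement_inf_le_iff:
  fixes a b x z :: "'k::{bounded_lattice, distrib_lattice}"
  assumes "is_complement a b"
  shows "inf a x \<le> z \<longleftrightarrow> x \<le> sup z b"
proof
  have ab: "inf a b = bot" "sup a b = top"
    using assms by (simp_all add: is_complement_def)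
  {
    assume le: "inf a x \<le> z"
    have "x = sup (inf a x) (inf b x)"
      using ab(2) by (simp add: inf_sup_distrib2[symmetric])
    also have "\<dots> \<le> sup z b" using le by (intro sup_mono) auto
    finally show "x \<le> sup z b" .
  }
  {
    assume "x \<le> sup z b"
    then have "inf a x \<le> inf a (sup z b)" by (intro inf_mono) auto
    also have "\<dots> = inf a z" using ab(1) by (simp add: inf_sup_distrib1)
    finally show "inf a x \<le> z" by simp
  }
qed

text \<open>Left adjoints preserve joins. The adjunction has to supply this because sublocales form
  the dual of a frame, where binary meets need not distribute over countable joins.\<close>

lemma complemented_inf_Sup:
  fixes a :: "'k::{countable_join_lattice, bounded_lattice, distrib_lattice}"
  assumes "complemented a" and A: "countable A"
  shows "inf a (Sup A) = Sup (inf a ` A)"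
proof (rule antisym)
  obtain b where b: "is_complement a b" using assms(1) by (auto simp: complemented_def)
  have cA: "countable (inf a ` A)" using A by simp
  have "x \<le> sup (Sup (inf a ` A)) b" if "x \<in> A" for x
    unfolding complement_inf_le_iff[OF b, symmetric]
    using that by (intro countable_Sup_upper[OF cA]) simp
  then show "inf a (Sup A) \<le> Sup (inf a ` A)"
    unfolding complement_inf_le_iff[OF b] by (rule countable_Sup_least[OF A])
  show "Sup (inf a ` A) \<le> inf a (Sup A)"
    by (rule countable_Sup_least[OF cA])
      (auto intro: le_infI2 countable_Sup_upper[OF A])
qed

text \<open>Distributivity carries the modular law over to the restriction; complementedness of
  \<open>a\<close> carries over continuity, since meeting with \<open>a\<close> then commutes with
  the join of the sequence.\<close>

lemma lattice_measure_restrict: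
  fixes \<mu> :: "'k::{countable_join_lattice, bounded_lattice, distrib_lattice} \<Rightarrow> ennreal"
  assumes \<mu>: "lattice_measure \<mu>" and a: "complemented a"
  shows "lattice_measure (\<lambda>x. \<mu> (inf a x))"
proof -
  note \<mu>D = lattice_measureD[OF \<mu>]
  show ?thesis
    unfolding lattice_measure_def
  proof (intro conjI allI impI)
    show "\<mu> (inf a bot) = 0" using \<mu>D(1) by simp
    show "\<mu> (inf a x) \<le> \<mu> (inf a y)" if "x \<le> y" for x y
      using that by (intro \<mu>D(2) inf_mono) simp_all
    show "\<mu> (inf a x) + \<mu> (inf a y) = \<mu> (inf a (sup x y)) + \<mu> (inf a (inf x y))" for x y
      using \<mu>D(3)[of "inf a x" "inf a y"]
      by (simp add: inf_sup_distrib1 inf_left_commute inf_assoc)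
    show "\<mu> (inf a (SUP i. X i)) = (SUP i. \<mu> (inf a (X i)))" if X: "incseq X" for X :: "nat \<Rightarrow> _"
    proof -
      have "incseq (\<lambda>i. inf a (X i))"
        using X by (auto simp: incseq_def intro: le_infI2)
      from \<mu>D(4)[OF this] show ?thesis
        by (simp add: complemented_inf_Sup[OF a] image_image)
    qed
  qed
qed

section \<open>Complements in a sigma-frame\<close>

text \<open>As \<open>compl\<close> is a definite description, uniqueness is required: by the
  adjunction any two complements lie below each other.\<close>

lemma is_complement_compl:
  fixes a :: "'n::{bounded_lattice, distrib_lattice}"
  assumes "complemented a"
  shows "is_complement a (compl a)"
proof -
  have le: "x \<le> y" if "is_complement a x" "is_complement a y" for x y
    using complement_inf_le_iff[OF that(2), of x bot] that(1) by (simp add: is_complement_def)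
  show ?thesis
    unfolding compl_def
    by (rule theI') (use assms le in \<open>auto simp: complemented_def intro: antisym\<close>)
qed

text \<open>Dualizing exchanges the two equations relating \<open>a\<close> and
  \<open>compl a\<close>. These are the elements to which the integral restricts the
  measure.\<close>

lemma complemented_dual_compl:
  fixes a :: "'n::{bounded_lattice, distrib_lattice}"
  assumes "complemented a"
  shows "complemented (dual (compl a))"
proof -
  have "is_complement (dual (compl a)) (dual a)"
    using is_complement_compl[OF assms]
    by (simp add: is_complement_def dual_eq_iff inf_commute sup_commute)
  then show ?thesis by (auto simp: complemented_def)
qed


section \<open>Functions that are locally constant on a cover\<close>

text \<open>\<open>const_on u v a r\<close> says that the function with values \<open>u\<close> and \<open>v\<close> on the generators
  restricts to the constant function \<open>r\<close> on the open sublocale given by \<open>a\<close>.\<close>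

definition const_on :: "(rat \<Rightarrow> 'n::sigma_frame) \<Rightarrow> (rat \<Rightarrow> 'n) \<Rightarrow> 'n \<Rightarrow> rat \<Rightarrow> bool" where
  "const_on u v a r \<longleftrightarrow>
     (\<forall>p. inf a (u p) = (if p < r then a else bot)) \<and>
     (\<forall>q. inf a (v q) = (if r < q then a else bot))"

abbreviation M_const_on :: "(real_frame \<Rightarrow> 'n::sigma_frame) \<Rightarrow> 'n \<Rightarrow> rat \<Rightarrow> bool" where
  "M_const_on f \<equiv> const_on (\<lambda>p. f (ray_above p)) (\<lambda>q. f (ray_below q))"

lemma const_onD:
  assumes "const_on u v a r"
  shows "inf a (u p) = (if p < r then a else bot)"
    and "inf a (v q) = (if r < q then a else bot)"
  using assms by (simp_all add: const_on_def)

lemma inf_countable_Sup: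
  fixes a :: "'n::sigma_frame"
  assumes "countable A"
  shows "inf a (Sup A) = Sup (inf a ` A)"
  using countable_Sup_inf[OF assms, of a] by (simp add: inf_commute)

lemma inf_countable_SUP:
  fixes a :: "'n::sigma_frame"
  assumes "countable X"
  shows "inf a (Sup (f ` X)) = Sup ((\<lambda>x. inf a (f x)) ` X)"
  using assms by (simp add: inf_countable_Sup image_image)

text \<open>On a piece \<open>a\<close> where a function is constant, its generator values become
  \<open>a\<close> or \<open>bot\<close>; this turns joins of them into existence questions about
  rationals.\<close>

lemma Sup_image_if:
  fixes a :: "'n::sigma_frame"
  assumes "countable X"
  shows "Sup ((\<lambda>x. if Q x then a else bot) ` X) = (if \<exists>x\<in>X. Q x then a else bot)"
proof (rule antisym)
  have c: "countable ((\<lambda>x. if Q x then a else bot) ` X)" using assms by simp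
  show "Sup ((\<lambda>x. if Q x then a else bot) ` X) \<le> (if \<exists>x\<in>X. Q x then a else bot)"
    by (rule countable_Sup_least[OF c]) auto
  show "(if \<exists>x\<in>X. Q x then a else bot) \<le> Sup ((\<lambda>x. if Q x then a else bot) ` X)"
  proof (cases "\<exists>x\<in>X. Q x")
    case True
    then show ?thesis by (auto intro!: countable_Sup_upper[OF c] simp del: if_image_distrib)
  qed simp
qed

lemma const_on_mono:
  assumes "const_on u v a r" "b \<le> a"
  shows "const_on u v b r"
proof -
  have b: "inf b x = inf b (inf a x)" for x
    using assms(2) by (simp add: inf_assoc[symmetric] inf_absorb1)
  show ?thesis
    unfolding const_on_def b[of "u _"] b[of "v _"] const_onD[OF assms(1)]
    using assms(2) by (simp add: inf_absorb1)
qed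

text \<open>Allows the pieces of a cover that share a value to be merged into one; countable
  distributivity is the reason.\<close>

lemma const_on_Sup:
  assumes "countable A" "\<And>a. a \<in> A \<Longrightarrow> const_on u v a r"
  shows "const_on u v (Sup A) r"
proof -
  have "inf (Sup A) (u p) = (if p < r then Sup A else bot)" for p
  proof -
    have "inf (Sup A) (u p) = Sup ((\<lambda>a. if p < r then a else bot) ` A)"
      unfolding countable_Sup_inf[OF assms(1)]
      by (intro arg_cong[where f = Sup] image_cong) (auto simp: const_onD[OF assms(2)])
    \<comment> \<open>If \<open>p < r\<close> the image is \<open>A\<close> itself. Otherwise every
      entry is \<open>bot\<close>, and the instance with a false condition evaluates the
      join.\<close>
    then show ?thesis using Sup_image_if[OF assms(1), of "\<lambda>_. False" bot] by auto
  qed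
  moreover have "inf (Sup A) (v q) = (if r < q then Sup A else bot)" for q
  proof -
    have "inf (Sup A) (v q) = Sup ((\<lambda>a. if r < q then a else bot) ` A)"
      unfolding countable_Sup_inf[OF assms(1)]
      by (intro arg_cong[where f = Sup] image_cong) (auto simp: const_onD[OF assms(2)])
    then show ?thesis using Sup_image_if[OF assms(1), of "\<lambda>_. False" bot] by auto
  qed
  ultimately show ?thesis by (simp add: const_on_def)
qed

lemma const_on_disjoint:
  assumes a: "const_on u v a r" and b: "const_on u v b s" and "r \<noteq> s"
  shows "inf a b = bot"
proof -
  have *: "inf x y = bot"
    if x: "const_on u v x p" and y: "const_on u v y q" and "p < q" for x y p q
  proof -
    \<comment> \<open>The generator value \<open>u p\<close> at the smaller constant separates the
      pieces: it contains \<open>y\<close> because \<open>p < q\<close>, and misses \<open>x\<close>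
      because the ray above \<open>p\<close> excludes \<open>p\<close>.\<close>
    have "inf x y = inf x (inf y (u p))" using const_onD(1)[OF y, of p] \<open>p < q\<close> by simp
    also have "\<dots> = inf y (inf x (u p))" by (simp add: inf_left_commute)
    also have "\<dots> = bot" using const_onD(1)[OF x, of p] by simp
    finally show ?thesis .
  qed
  show ?thesis
    using *[OF a b] *[OF b a] \<open>r \<noteq> s\<close> by (metis inf_commute linorder_neqE)
qed

lemma eq_on_cover:
  fixes x y :: "'n::sigma_frame"
  assumes "countable P" "Sup P = top" and "\<And>a. a \<in> P \<Longrightarrow> inf a x = inf a y"
  shows "x = y"
proof -
  have "inf (Sup P) x = inf (Sup P) y"
    unfolding countable_Sup_inf[OF assms(1)] using assms(3)
    by (intro arg_cong[where f = Sup] image_cong) auto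
  then show ?thesis by (simp add: assms(2))
qed

text \<open>On each piece the relations reduce to facts about rationals: order for the first two,
  density for the two approximation relations, and unboundedness for the last two.\<close>

lemma real_relations_of_cover:
  fixes u v :: "rat \<Rightarrow> 'n::sigma_frame"
  assumes P: "countable P" "Sup P = top" and c: "\<And>a. a \<in> P \<Longrightarrow> \<exists>r. const_on u v a r"
  shows "real_relations u v"
proof -
  have eqI: "x = y" if "\<And>a r. const_on u v a r \<Longrightarrow> inf a x = inf a y" for x y
    using eq_on_cover[OF P] that c by metis
  show ?thesis
    unfolding real_relations_def
  proof (intro conjI allI impI)
    show "inf (u p) (v q) = bot" if "p \<ge> q" for p q
    proof (rule eqI)
      fix a r assume ar: "const_on u v a r"
      have "inf a (inf (u p) (v q)) = inf (inf a (u p)) (inf a (v q))"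
        by (simp add: inf_left_commute inf_assoc)
      then show "inf a (inf (u p) (v q)) = inf a bot"
        using \<open>p \<ge> q\<close> by (simp add: const_onD[OF ar])
    qed
    show "sup (u p) (v q) = top" if "p < q" for p q
    proof (rule eqI)
      fix a r assume ar: "const_on u v a r"
      show "inf a (sup (u p) (v q)) = inf a top"
        using \<open>p < q\<close> by (auto simp: inf_sup_distrib1 const_onD[OF ar])
    qed
    show "u p = Sup (u ` {r. r > p})" for p
    proof (rule eqI)
      fix a r assume ar: "const_on u v a r"
      show "inf a (u p) = inf a (Sup (u ` {r. r > p}))"
        using dense[of p r] by (auto simp: inf_countable_SUP Sup_image_if const_onD[OF ar] simp del: if_image_distrib)
    qed
    show "v q = Sup (v ` {s. s < q})" for q
    proof (rule eqI)
      fix a r assume ar: "const_on u v a r"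
      show "inf a (v q) = inf a (Sup (v ` {s. s < q}))"
        using dense[of r q] by (auto simp: inf_countable_SUP Sup_image_if const_onD[OF ar] simp del: if_image_distrib)
    qed
    show "Sup (range u) = top"
    proof (rule eqI)
      fix a r assume ar: "const_on u v a r"
      show "inf a (Sup (range u)) = inf a top"
        using lt_ex[of r] by (auto simp: inf_countable_SUP Sup_image_if const_onD[OF ar] simp del: if_image_distrib)
    qed
    show "Sup (range v) = top"
    proof (rule eqI)
      fix a r assume ar: "const_on u v a r"
      show "inf a (Sup (range v)) = inf a top"
        using gt_ex[of r] by (auto simp: inf_countable_SUP Sup_image_if const_onD[OF ar] simp del: if_image_distrib)
    qed
  qed
qed

text \<open>The universal property makes the definite description in \<open>M_of\<close> meaningful
  once the relations hold.\<close>

lemma M_of_spec: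
  assumes "real_relations u v"
  shows "M_of u v \<in> M_homs"
    and "M_of u v (ray_above p) = u p"
    and "M_of u v (ray_below q) = v q"
proof -
  have "\<exists>!h. h \<in> M_homs \<and> (\<forall>p. h (ray_above p) = u p) \<and> (\<forall>q. h (ray_below q) = v q)"
    using real_frame_universal[OF assms] by (simp add: M_homs_def)
  from theI'[OF this, folded M_of_def] show "M_of u v \<in> M_homs" "M_of u v (ray_above p) = u p" "M_of u v (ray_below q) = v q"
    by auto
qed

lemma M_homs_eq_of_cover:
  assumes "f \<in> M_homs" "g \<in> M_homs" and P: "countable P" "Sup P = top"
    and c: "\<And>a. a \<in> P \<Longrightarrow> \<exists>r. M_const_on f a r \<and> M_const_on g a r"
  shows "f = g"
proof (rule real_frame_hom_determined)
  show "sigma_frame_hom f" "sigma_frame_hom g" using assms(1,2) by (simp_all add: M_homs_def)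
  show "f (ray_above p) = g (ray_above p)" for p
    by (rule eq_on_cover[OF P]) (metis c const_onD(1))
  show "f (ray_below q) = g (ray_below q)" for q
    by (rule eq_on_cover[OF P]) (metis c const_onD(2))
qed

section \<open>Step functions\<close>

text \<open>A property weaker in form than being a sum of characteristic functions and easier to
  propagate through the operations; the members of \<open>P\<close> may overlap or be
  \<open>bot\<close>.\<close>

definition M_step :: "(real_frame \<Rightarrow> 'n::sigma_frame) \<Rightarrow> bool" where
  "M_step f \<longleftrightarrow> f \<in> M_homs \<and>
     (\<exists>P. finite P \<and> Sup P = top \<and> (\<forall>a\<in>P. \<exists>r. M_const_on f a r))"

text \<open>The common pattern for all operations: a finite cover on which the prescribed generator
  values are constant gives both well-definedness and the resulting constants.\<close>

lemma M_step_M_of: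
  assumes P: "finite P" "Sup P = top" and c: "\<And>a. a \<in> P \<Longrightarrow> \<exists>r. const_on u v a r"
  shows "M_step (M_of u v)" and "M_const_on (M_of u v) a r \<longleftrightarrow> const_on u v a r"
proof -
  have rel: "real_relations u v"
    by (rule real_relations_of_cover[OF countable_finite[OF P(1)] P(2) c])
  show "M_const_on (M_of u v) a r \<longleftrightarrow> const_on u v a r" for a r
    by (simp add: M_of_spec[OF rel])
  have "\<forall>a\<in>P. \<exists>r. M_const_on (M_of u v) a r" using c by (simp add: M_of_spec[OF rel])
  then show "M_step (M_of u v)"
    unfolding M_step_def using M_of_spec(1)[OF rel] P by auto
qed

section \<open>Closure of step functions under the operations\<close>

lemma
  fixes a :: "'n::sigma_frame"
  shows M_step_zero: "M_step (M_zero :: real_frame \<Rightarrow> 'n)"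
    and M_const_on_zero: "M_const_on M_zero a 0"
proof -
  let ?u = "\<lambda>p::rat. if p < 0 then top else (bot::'n)"
  let ?v = "\<lambda>q::rat. if q > 0 then top else (bot::'n)"
  have c: "const_on ?u ?v a 0" for a by (simp add: const_on_def)
  then have ex: "\<exists>r. const_on ?u ?v a r" for a by blast
  have P: "finite {top::'n}" "Sup {top::'n} = top"
    using countable_Sup_pair[of top "top::'n"] by simp_all
  show "M_step (M_zero :: _ \<Rightarrow> 'n)" "M_const_on M_zero a 0"
    using M_step_M_of[OF P ex] c by (simp_all add: M_zero_def)
qed

lemma M_step_chi:
  fixes a :: "'n::sigma_frame"
  assumes "complemented a"
  shows "M_step (M_chi a)"
    and "b \<le> a \<Longrightarrow> M_const_on (M_chi a) b 1"
    and "inf a b = bot \<Longrightarrow> M_const_on (M_chi a) b 0"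
proof -
  let ?u = "\<lambda>p::rat. if p < 0 then top else if p < 1 then a else bot"
  let ?v = "\<lambda>q::rat. if q \<le> 0 then bot else if q \<le> 1 then compl a else top"
  have ca: "inf a (compl a) = bot" "sup a (compl a) = top"
    using is_complement_compl[OF assms] by (simp_all add: is_complement_def)
  have "const_on ?u ?v a 1" using ca(1) by (auto simp: const_on_def)
  then have 1: "const_on ?u ?v b 1" if "b \<le> a" for b
    using that by (rule const_on_mono)
  have 0: "const_on ?u ?v b 0" if b: "inf a b = bot" for b
  proof -
    \<comment> \<open>By the adjunction \<open>b\<close> lies below the complement, so the generator
      value \<open>compl a\<close> for \<open>0 < q \<le> 1\<close> meets \<open>b\<close> in all of
      \<open>b\<close>.\<close>
    have "b \<le> compl a"
      using complement_inf_le_iff[OF is_complement_compl[OF assms], of b bot] b by simp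
    then show ?thesis
      using b by (auto simp: const_on_def inf_commute inf_absorb1)
  qed
  have P: "finite {a, compl a}" "Sup {a, compl a} = top"
    by (simp_all add: countable_Sup_pair ca(2))
  have c: "\<exists>r. const_on ?u ?v b r" if "b \<in> {a, compl a}" for b
    using that 0[OF ca(1)] 1[of a] by auto
  note st = M_step_M_of[OF P c]
  show "M_step (M_chi a)" unfolding M_chi_def using st(1) by blast
  show "b \<le> a \<Longrightarrow> M_const_on (M_chi a) b 1" unfolding M_chi_def using st(2) 1 by blast
  show "inf a b = bot \<Longrightarrow> M_const_on (M_chi a) b 0" unfolding M_chi_def using st(2) 0 by blast
qed

lemma M_step_scale_pos:
  assumes "M_step f" "l > 0"
  shows "M_step (M_scale_pos l f)"
    and "M_const_on f a r \<Longrightarrow> M_const_on (M_scale_pos l f) a (l * r)"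
proof -
  let ?u = "\<lambda>p. f (ray_above (p / l))" and ?v = "\<lambda>q. f (ray_below (q / l))"
  have c: "const_on ?u ?v a (l * r)" if "M_const_on f a r" for a r
    using assms(2) by (simp add: const_on_def const_onD[OF that] field_simps)
  obtain P where P: "finite P" "Sup P = top" "\<And>a. a \<in> P \<Longrightarrow> \<exists>r. M_const_on f a r"
    using assms(1) by (auto simp: M_step_def)
  then have "\<exists>r. const_on ?u ?v a r" if "a \<in> P" for a using that c by blast
  note st = M_step_M_of[OF P(1,2) this]
  show "M_step (M_scale_pos l f)" unfolding M_scale_pos_def using st(1) by blast
  show "M_const_on f a r \<Longrightarrow> M_const_on (M_scale_pos l f) a (l * r)"
    unfolding M_scale_pos_def using st(2) c by blast
qed

lemma M_step_uminus:
  assumes "M_step f"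
  shows "M_step (M_uminus f)"
    and "M_const_on f a r \<Longrightarrow> M_const_on (M_uminus f) a (- r)"
proof -
  let ?u = "\<lambda>p. f (ray_below (- p))" and ?v = "\<lambda>q. f (ray_above (- q))"
  have c: "const_on ?u ?v a (- r)" if "M_const_on f a r" for a r
    by (auto simp: const_on_def const_onD[OF that])
  obtain P where P: "finite P" "Sup P = top" "\<And>a. a \<in> P \<Longrightarrow> \<exists>r. M_const_on f a r"
    using assms by (auto simp: M_step_def)
  then have "\<exists>r. const_on ?u ?v a r" if "a \<in> P" for a using that c by blast
  note st = M_step_M_of[OF P(1,2) this]
  show "M_step (M_uminus f)" unfolding M_uminus_def using st(1) by blast
  show "M_const_on f a r \<Longrightarrow> M_const_on (M_uminus f) a (- r)"
    unfolding M_uminus_def using st(2) c by blast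
qed

lemma M_step_scale:
  assumes "M_step f"
  shows "M_step (M_scale l f)"
    and "M_const_on f a r \<Longrightarrow> M_const_on (M_scale l f) a (l * r)"
proof -
  have neg: "M_step (M_scale_pos (- l) f)" if "l < 0"
    using M_step_scale_pos(1)[OF assms, of "- l"] that by simp
  show "M_step (M_scale l f)"
    using M_step_scale_pos(1)[OF assms] M_step_uminus(1)[OF neg] M_step_zero
    by (auto simp: M_scale_def)
  assume r: "M_const_on f a r"
  show "M_const_on (M_scale l f) a (l * r)"
  proof (cases l "0 :: rat" rule: linorder_cases)
    case less
    have "M_const_on (M_uminus (M_scale_pos (- l) f)) a (- (- l * r))"
      by (intro M_step_uminus(2) neg M_step_scale_pos(2) assms r) (use less in auto)
    then show ?thesis using less by (simp add: M_scale_def)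
  next
    case equal
    then show ?thesis using M_const_on_zero by (simp add: M_scale_def)
  next
    case greater
    then show ?thesis using M_step_scale_pos(2)[OF assms _ r] by (simp add: M_scale_def)
  qed
qed

lemma M_step_add:
  assumes f: "M_step f" and g: "M_step g"
  shows "M_step (M_add f g)"
    and "M_const_on f a r \<Longrightarrow> M_const_on g a s \<Longrightarrow> M_const_on (M_add f g) a (r + s)"
proof -
  let ?u = "\<lambda>p. SUP t. inf (f (ray_above t)) (g (ray_above (p - t)))"
  let ?v = "\<lambda>q. SUP t. inf (f (ray_below t)) (g (ray_below (q - t)))"
  have c: "const_on ?u ?v a (r + s)" if r: "M_const_on f a r" and s: "M_const_on g a s" for a r s
  proof -
    have inf3: "inf a (inf x y) = inf (inf a x) (inf a y)" for x y
      by (simp add: inf_left_commute inf_assoc)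
    have if_inf: "inf (if Q then a else bot) (if R then a else bot) = (if Q \<and> R then a else bot)"
      for Q R by simp
    \<comment> \<open>On \<open>a\<close>, the joinand at \<open>t\<close> is \<open>a\<close>
      exactly when both inequalities hold. By density such a \<open>t\<close> exists between
      \<open>p - s\<close> and \<open>r\<close> precisely when \<open>p < r + s\<close>.\<close>
    have above: "(\<exists>t. t < r \<and> p - t < s) \<longleftrightarrow> p < r + s" for p
    proof
      assume "p < r + s"
      then have "p - s < r" by simp
      then obtain t where "p - s < t" "t < r" using dense by blast
      then show "\<exists>t. t < r \<and> p - t < s" by (intro exI[of _ t]) simp
    qed auto
    have below: "(\<exists>t. r < t \<and> s < q - t) \<longleftrightarrow> r + s < q" for q
    proof
      assume "r + s < q"
      then have "r < q - s" by simp
      then obtain t where "r < t" "t < q - s" using dense by blast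
      then show "\<exists>t. r < t \<and> s < q - t" by (intro exI[of _ t]) simp
    qed auto
    show ?thesis
      unfolding const_on_def inf_countable_SUP[OF countableI_type] inf3
        const_onD[OF r] const_onD[OF s] if_inf Sup_image_if[OF countableI_type]
      by (simp add: above below)
  qed
  obtain P where P: "finite P" "Sup P = top" "\<And>a. a \<in> P \<Longrightarrow> \<exists>r. M_const_on f a r"
    using f by (auto simp: M_step_def)
  obtain Q where Q: "finite Q" "Sup Q = top" "\<And>a. a \<in> Q \<Longrightarrow> \<exists>r. M_const_on g a r"
    using g by (auto simp: M_step_def)
  let ?R = "(\<lambda>(a, b). inf a b) ` (P \<times> Q)"
  have R: "finite ?R" using P(1) Q(1) by simp
  have R_top: "Sup ?R = top"
  proof (rule antisym[OF top_greatest])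
    have "a \<le> Sup ?R" if a: "a \<in> P" for a
    proof -
      have "a = Sup (inf a ` Q)"
        \<comment> \<open>Since \<open>Q\<close> covers, each member of \<open>P\<close> is the join
          of its meets with \<open>Q\<close>; hence the pairwise meets cover as well.\<close>
        using inf_countable_Sup[OF countable_finite[OF Q(1)], of a] Q(2) by simp
      also have "\<dots> \<le> Sup ?R"
        using R Q(1) a
        by (intro countable_Sup_least) (auto intro!: countable_Sup_upper countable_finite)
      finally show ?thesis .
    qed
    then have "Sup P \<le> Sup ?R" by (intro countable_Sup_least countable_finite P(1))
    then show "top \<le> Sup ?R" by (simp add: P(2))
  qed
  have "\<exists>r. const_on ?u ?v x r" if x: "x \<in> ?R" for x
  proof -
    obtain a b where ab: "a \<in> P" "b \<in> Q" "x = inf a b" using x by auto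
    obtain r s where rs: "M_const_on f a r" "M_const_on g b s" using P(3) Q(3) ab by blast
    have "const_on ?u ?v x (r + s)"
      by (rule c; rule const_on_mono[OF rs(1)] const_on_mono[OF rs(2)]; simp add: ab(3))
    then show ?thesis by blast
  qed
  note st = M_step_M_of[OF R R_top this]
  show "M_step (M_add f g)" unfolding M_add_def using st(1) by blast
  show "M_const_on f a r \<Longrightarrow> M_const_on g a s \<Longrightarrow> M_const_on (M_add f g) a (r + s)"
    unfolding M_add_def using st(2) c by blast
qed

section \<open>Values of linear combinations of characteristic functions\<close>

lemma M_lincomb_simps:
  "M_lincomb [] = M_zero"
  "M_lincomb ((r, a) # xs) = M_add (M_scale r (M_chi a)) (M_lincomb xs)"
  by (simp_all add: M_lincomb_def)

lemma M_step_lincomb: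
  assumes "\<forall>(r, a) \<in> set xs. complemented a"
  shows "M_step (M_lincomb xs)"
  using assms
  by (induction xs)
    (auto simp: M_lincomb_simps intro!: M_step_zero M_step_add(1) M_step_scale(1) M_step_chi(1))

lemma M_const_on_lincomb_disjoint:
  assumes "\<forall>(r, a) \<in> set xs. complemented a \<and> inf a b = bot"
  shows "M_const_on (M_lincomb xs) b 0"
  using assms
proof (induction xs)
  case Nil
  then show ?case by (simp add: M_lincomb_simps M_const_on_zero)
next
  case (Cons x xs)
  obtain r a where x: "x = (r, a)" by (cases x)
  have a: "complemented a" "inf a b = bot" using Cons.prems x by auto
  \<comment> \<open>The value is kept as \<open>r * 0 + 0\<close> to match the rules for multiples
    and sums.\<close>
  have "M_const_on (M_add (M_scale r (M_chi a)) (M_lincomb xs)) b (r * 0 + 0)"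
    by (rule M_step_add(2)) (use Cons a in
      \<open>auto intro!: M_step_scale M_step_chi M_step_lincomb simp del: mult_zero_right\<close>)
  then show ?case by (simp add: x M_lincomb_simps)
qed

text \<open>By disjointness only the term \<open>(s, b)\<close> contributes on \<open>b\<close>: the
  tail vanishes on the head coefficient, and the head vanishes on each tail coefficient.\<close>

lemma M_const_on_lincomb:
  assumes "\<forall>(r, a) \<in> set xs. complemented a"
    and "sorted_wrt (\<lambda>a b. inf a b = bot) (map snd xs)" and "(s, b) \<in> set xs"
  shows "M_const_on (M_lincomb xs) b s"
  using assms
proof (induction xs)
  case Nil
  then show ?case by simp
next
  case (Cons x xs)
  obtain r a where x: "x = (r, a)" by (cases x)
  have a: "complemented a" and xs: "\<forall>(r, a) \<in> set xs. complemented a"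
    using Cons.prems(1) x by auto
  have disj: "inf a c = bot" if "(t, c) \<in> set xs" for t c
    using Cons.prems(2) that by (force simp: x)
  note step = M_step_scale(1)[OF M_step_chi(1)[OF a], of r] M_step_lincomb[OF xs]
  from Cons.prems(3) consider "s = r" "b = a" | "(s, b) \<in> set xs" using x by auto
  then show ?case
  proof cases
    case 1
    have "M_const_on (M_scale r (M_chi a)) a (r * 1)"
      by (intro M_step_scale(2) M_step_chi a) simp
    moreover have "M_const_on (M_lincomb xs) a 0"
      by (rule M_const_on_lincomb_disjoint) (use xs disj in \<open>auto simp: inf_commute\<close>)
    ultimately have "M_const_on (M_add (M_scale r (M_chi a)) (M_lincomb xs)) a (r * 1 + 0)"
      by (rule M_step_add(2)[OF step])
    then show ?thesis by (simp add: x 1 M_lincomb_simps)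
  next
    case 2
    have "M_const_on (M_scale r (M_chi a)) b (r * 0)"
      by (intro M_step_scale(2) M_step_chi a disj[OF 2])
    moreover have "M_const_on (M_lincomb xs) b s"
      by (rule Cons.IH) (use xs Cons.prems(2) 2 in auto)
    ultimately have "M_const_on (M_add (M_scale r (M_chi a)) (M_lincomb xs)) b (r * 0 + s)"
      by (rule M_step_add(2)[OF step])
    then show ?thesis by (simp add: x M_lincomb_simps)
  qed
qed

section \<open>Canonical forms\<close>

lemma canonical_const_on:
  assumes "canonical xs" "(r, a) \<in> set xs"
  shows "M_const_on (M_lincomb xs) a r"
  by (rule M_const_on_lincomb) (use assms in \<open>auto simp: canonical_def\<close>)

text \<open>The coefficients of \<open>ys\<close> cover \<open>a\<close>, and those with a value
  other than \<open>r\<close> are disjoint from it. As \<open>a\<close> is nonzero, the value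
  \<open>r\<close> must occur in \<open>ys\<close>, and its single coefficient then contains
  \<open>a\<close>.\<close>

lemma canonical_coeff_le:
  assumes xs: "canonical xs" and ys: "canonical ys" and eq: "M_lincomb xs = M_lincomb ys"
    and ra: "(r, a) \<in> set xs"
  shows "\<exists>b. (r, b) \<in> set ys \<and> a \<le> b"
proof -
  have a: "a \<noteq> bot" using xs ra by (auto simp: canonical_def)
  have *: "inf a b = bot" if "(s, b) \<in> set ys" "s \<noteq> r" for s b
    by (rule const_on_disjoint[OF canonical_const_on[OF xs ra]
          canonical_const_on[OF ys that(1), folded eq]]) (use that in auto)
  have fin: "countable (set (map snd ys))" by (simp add: countable_finite)
  have a_eq: "a = Sup (inf a ` set (map snd ys))"
    using ys inf_countable_Sup[OF fin, of a] by (simp add: canonical_def)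
  have "\<exists>b. (r, b) \<in> set ys"
  proof (rule ccontr)
    assume "\<not> ?thesis"
    then have "inf a b = bot" if "b \<in> set (map snd ys)" for b using that * by fastforce
    then have "Sup (inf a ` set (map snd ys)) \<le> bot"
      by (intro countable_Sup_least countable_image fin) auto
    then show False using a a_eq by (simp add: bot_unique)
  qed
  then obtain b where b: "(r, b) \<in> set ys" by blast
  have dist: "distinct (map fst ys)"
    using ys by (simp add: canonical_def strict_sorted_iff)
  have "inf a c \<le> b" if c: "c \<in> set (map snd ys)" for c
  proof -
    obtain s where s: "(s, c) \<in> set ys" using c by auto
    show ?thesis
    proof (cases "s = r")
      case True
      then have "c = b" using s b dist by (auto dest: eq_key_imp_eq_value)
      then show ?thesis by simp
    next
      case False
      then show ?thesis using *[OF s] by simp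
    qed
  qed
  then have "Sup (inf a ` set (map snd ys)) \<le> b"
    by (intro countable_Sup_least countable_image fin) auto
  then show ?thesis using a_eq b by auto
qed

text \<open>Comparing coefficients forth and back gives \<open>a \<le> b \<le> c\<close>, where
  \<open>c = a\<close> because values do not repeat in \<open>xs\<close>.\<close>

lemma canonical_subset:
  assumes xs: "canonical xs" and ys: "canonical ys" and eq: "M_lincomb xs = M_lincomb ys"
  shows "set xs \<subseteq> set ys"
proof
  fix x assume x: "x \<in> set xs"
  obtain r a where ra: "x = (r, a)" by (cases x)
  obtain b where b: "(r, b) \<in> set ys" "a \<le> b"
    using canonical_coeff_le[OF xs ys eq] x ra by blast
  obtain c where c: "(r, c) \<in> set xs" "b \<le> c"
    using canonical_coeff_le[OF ys xs eq[symmetric] b(1)] by blast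
  have "distinct (map fst xs)" using xs by (simp add: canonical_def strict_sorted_iff)
  then have "c = a" using c(1) x ra by (auto dest: eq_key_imp_eq_value)
  then have "a = b" using b(2) c(2) by (simp add: antisym)
  then show "x \<in> set ys" using b(1) ra by simp
qed

text \<open>A list with strictly increasing values is determined by its set of entries.\<close>

lemma canonical_unique:
  assumes xs: "canonical xs" and ys: "canonical ys" and eq: "M_lincomb xs = M_lincomb ys"
  shows "xs = ys"
proof (rule map_sorted_distinct_set_unique[where f = fst])
  show set_eq: "set xs = set ys"
    using canonical_subset[OF xs ys eq] canonical_subset[OF ys xs eq[symmetric]] by simp
  show "sorted (map fst xs)" "distinct (map fst xs)" "sorted (map fst ys)" "distinct (map fst ys)"
    using xs ys by (simp_all add: canonical_def strict_sorted_iff)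
  then show "inj_on fst (set xs \<union> set ys)" by (simp add: set_eq distinct_map)
qed

text \<open>Grouping the pieces of a cover by value gives the canonical form; pieces with different
  values are automatically disjoint, so the cover need not be a partition.\<close>

lemma canonical_exists:
  assumes f: "M_step f"
  shows "\<exists>xs. canonical xs \<and> f = M_lincomb xs"
proof -
  obtain P where P: "finite P" "Sup P = top" "\<And>a. a \<in> P \<Longrightarrow> \<exists>r. M_const_on f a r"
    using f by (auto simp: M_step_def)
  \<comment> \<open>A value is chosen for each piece: on \<open>bot\<close> every rational
    qualifies.\<close>
  obtain val where val: "\<And>a. a \<in> P \<Longrightarrow> M_const_on f a (val a)" using P(3) by metis
  define A where "A c = Sup {a \<in> P. val a = c}" for c
  \<comment> \<open>Values whose merged piece is \<open>bot\<close> are discarded, as canonical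
    coefficients are nonzero; the cover loses only \<open>bot\<close> pieces.\<close>
  define R where "R = {c \<in> val ` P. A c \<noteq> bot}"
  define xs where "xs = map (\<lambda>c. (c, A c)) (sorted_list_of_set R)"
  have finR: "finite R" using P(1) by (simp add: R_def)
  have sets: "set xs = (\<lambda>c. (c, A c)) ` R" using finR by (simp add: xs_def)
  have A: "M_const_on f (A c) c" for c
    unfolding A_def using P(1) by (intro const_on_Sup) (auto intro: val countable_finite)
  have disj: "inf (A c) (A d) = bot" if "c \<noteq> d" for c d
    by (rule const_on_disjoint[OF A A that])
  have top: "Sup (A ` R) = top"
  proof (rule antisym[OF top_greatest])
    have "a \<le> Sup (A ` R)" if a: "a \<in> P" for a
    proof -
      have le: "a \<le> A (val a)"
        unfolding A_def using P(1) a by (intro countable_Sup_upper) (auto intro: countable_finite)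
      show ?thesis
      proof (cases "A (val a) = bot")
        case True
        then have "a = bot" using le by (simp add: bot_unique)
        then show ?thesis by simp
      next
        case False
        then have "A (val a) \<le> Sup (A ` R)"
          using a finR by (intro countable_Sup_upper) (auto simp: R_def intro: countable_finite)
        then show ?thesis using le by simp
      qed
    qed
    then have "Sup P \<le> Sup (A ` R)" by (intro countable_Sup_least countable_finite P(1))
    then show "top \<le> Sup (A ` R)" by (simp add: P(2))
  qed
  have compl: "complemented (A c)" if c: "c \<in> R" for c
  proof -
    \<comment> \<open>The complement of a merged piece is the join of all the others.\<close>
    let ?B = "Sup (A ` (R - {c}))"
    have cnt: "countable (A ` (R - {c}))" using finR by (simp add: countable_finite)
    have "inf (A c) ?B \<le> bot"
      unfolding inf_countable_Sup[OF cnt] using cnt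
      by (intro countable_Sup_least) (auto, metis disj order_refl)
    moreover have "Sup (A ` R) \<le> sup (A c) ?B"
    proof (rule countable_Sup_least)
      show "countable (A ` R)" using finR by (simp add: countable_finite)
      show "x \<le> sup (A c) ?B" if "x \<in> A ` R" for x
        using that c by (cases "x = A c") (auto intro!: le_supI2 countable_Sup_upper[OF cnt])
    qed
    ultimately have "is_complement (A c) ?B"
      by (simp add: is_complement_def top bot_unique top_unique)
    then show ?thesis by (auto simp: complemented_def)
  qed
  have "sorted_wrt (\<lambda>a b. inf a b = bot) (map snd xs)"
    unfolding xs_def map_map comp_def snd_conv sorted_wrt_map
    by (rule sorted_wrt_mono_rel[OF _ strict_sorted_list_of_set]) (auto intro: disj)
  then have can: "canonical xs"
    unfolding canonical_def
    by (auto simp: sets compl R_def image_image top[unfolded R_def])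
      (auto simp: xs_def comp_def)
  have "f = M_lincomb xs"
  proof (rule M_homs_eq_of_cover)
    show "f \<in> M_homs" using f by (simp add: M_step_def)
    show "M_lincomb xs \<in> M_homs"
      using M_step_lincomb[of xs] can by (auto simp: M_step_def canonical_def)
    show "countable (A ` R)" using finR by (simp add: countable_finite)
    show "Sup (A ` R) = top" by (rule top)
    show "\<exists>r. M_const_on f a r \<and> M_const_on (M_lincomb xs) a r" if "a \<in> A ` R" for a
    proof -
      obtain c where c: "c \<in> R" "a = A c" using \<open>a \<in> A ` R\<close> by blast
      then have "(c, a) \<in> set xs" by (simp add: sets)
      from canonical_const_on[OF can this] show ?thesis using A c(2) by blast
    qed
  qed
  then show ?thesis using can by blast
qed

text \<open>Existence and uniqueness together justify the definite description in
  \<open>canonical_form\<close>.\<close>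

lemma canonical_canonical_form:
  assumes "g \<in> SM"
  shows "canonical (canonical_form g)"
proof -
  have "M_step g" using assms M_step_lincomb by (auto simp: SM_def)
  from canonical_exists[OF this]
  have "\<exists>!xs. canonical xs \<and> g = M_lincomb xs" using canonical_unique by auto
  then have "canonical (canonical_form g) \<and> g = M_lincomb (canonical_form g)"
    unfolding canonical_form_def by (rule theI')
  then show ?thesis ..
qed

section \<open>The indefinite integral as a finite sum of scaled restrictions\<close>

theorem theorem9p3:
  fixes \<mu> :: "'a::sigma_frame sigma_sublocale \<Rightarrow> ennreal"
    and g :: "real_frame \<Rightarrow> 'a congruence"
  assumes "lattice_measure \<mu>" and "g \<in> SM" and "M_nonneg g"
  shows "lattice_measure (\<lambda>S. simple_integral \<mu> g S)"
  unfolding simple_integral_def case_prod_unfold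
proof (intro lattice_measure_sum_list lattice_measure_mult lattice_measure_restrict assms(1)
    complemented_dual_compl)
  \<comment> \<open>The closure rules for sums, multiples and restrictions leave only the
    complementedness of each canonical coefficient.\<close>
  fix x assume "x \<in> set (canonical_form g)"
  then show "complemented (snd x)"
    using canonical_canonical_form[OF assms(2)] by (auto simp: canonical_def)
qed

end
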